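(* Let $S$ be a Polish space, $B>0$, and let $(X_1,Y_1),\dots,(X_n,Y_n)$ be a sequence of independent (not necessarily identically distributed) random elements of $S\times\mathbb{R}$ with $Y_k\in L^2_{\mathrm{P}}$ for $k=1,\dots,n$. Let $\mathcal{G}$ be a family of Borel measurable functions $S\to\mathbb{R}$ with $|g(x)|\le B$ for all $(g,x)\in\mathcal{G}\times S$, for which there exist $$\hat g\in\arg\min_{g\in\mathcal{G}}\sum_{k=1}^n|g(X_k)-T_BY_k|^2,\qquad\tilde g\in\arg\min_{g\in\mathcal{G}}\sum_{k=1}^n\mathrm{E}\big[|g(X_k)-T_BY_k|^2\big].$$ For $1\le k\le n$ let $\Phi_k:S\to\mathbb{R}$ be a Borel function with $\Phi_k(X_k)=\mathrm{E}[Y_k\mid X_k]$ almost surely, and let $\|\cdot\|_k$ be the $L^2$ norm associated to the law of $X_k$. Write $\xi(t)=1+t$ for $t>0$. Then for every $(c,\lambda,\eta,\eta',\delta)\in(1,\infty)\times(1,\infty)\times(0,\infty)\times(0,\infty)\times(0,1)$, the inequality $$\begin{aligned}\frac1n\sum_{k=1}^n\|\hat g-\Phi_k\|_k^2\le{}&\xi(\eta)\Bigg(\xi(\eta')(6\lambda-5)\inf_{g\in\mathcal{G}}\frac1n\sum_{k=1}^n\|g-\Phi_k\|_k^2\\&\quad+6\max\left\{\epsilon_n(c,\lambda),\ \frac1{n\,b(c,\lambda)}\Big(\log a(c,\lambda,\epsilon_n(c,\lambda))+\log(2/\delta)\Big)\right\}\Bigg)\\&+\Big(\xi(1/\eta)+\xi(\eta)\,\xi(1/\eta')(6\lambda-5)\Big)\frac1n\sum_{k=1}^n\mathrm{E}\big[(|Y_k|-B)^2\mathbf{1}_{\{|Y_k|>B\}}\big]\end{aligned}$$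 holds with probability at least $1-\delta$, where $a$, $b$, $\epsilon_n$ are the functions defined in the context.
   Context: $T_By=\min\{\max\{y,-B\},B\}$ is the truncation operator, and $T_B\mathcal{G}=\{T_Bg:g\in\mathcal{G}\}$, where $(T_Bg)(x)=T_B(g(x))$. The function $\hat g$ depends on the sample; in $\|\hat g-\Phi_k\|_k^2=\int|\hat g(x)-\Phi_k(x)|^2\,\mathrm{P}_{X_k}(dx)$ the function $\hat g$ is held fixed, so this is a random quantity. Covering numbers: for $x_{1:n}\in S^n$, a family $\mathcal{F}$ of Borel functions $S\to\mathbb{R}$ and $r\ge0$, $\mathcal{N}_1(\mathcal{F},x_{1:n},r)$ is the smallest $m\in\mathbb{N}$ such that there is a set $\mathcal{L}_0$ of $m$ elements $l_{1:n}=(l_1,\dots,l_n)$, with each $l_k:S\to\mathbb{R}$ Borel, such that for every $f\in\mathcal{F}$ there is $l_{1:n}\in\mathcal{L}_0$ with $\frac1n\sum_{k=1}^n|l_k(x_k)-f(x_k)|\le r$ (and $\infty$ if there is none). For $c,\lambda>1$ and $\epsilon>0$ define $$A(x_{1:n},c,\lambda,\epsilon)=2(c+1)(2c+3)\,\mathcal{N}_1\left(T_B\mathcal{G},x_{1:n},\frac1{2^5}\frac1B\frac1{\lambda(c-1)+1}\Big(1-\frac1c\Big)\epsilon\right),\qquad a(c,\lambda,\epsilon)=\mathrm{E}[A(X_{1:n},c,\lambda,\epsilon)],$$ $$\epsilon_n(c,\lambda)=8B^2\left(-(\lambda-1)+\sqrt{(\lambda-1)^2+c(c+1)\lambda^2/n}\right),$$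 $$b(c,\lambda)=\frac1{2^5B^2}\,\frac1{\left(\frac13(1-\frac1c)(1-\frac1\lambda)+(2\lambda-1)\right)^2}\Big(1-\frac1c\Big)^3\Big(1-\frac1\lambda\Big).$$ Standing assumption: families of functions are nonempty and pointwise measurable, i.e. there is a countable subfamily of $\mathcal{G}$ such that every element of $\mathcal{G}$ is the pointwise limit of a sequence from that subfamily. *)

theory Defs
  imports "HOL-Probability.Probability"
begin

definition trunc :: "real \<Rightarrow> real \<Rightarrow> real" where
  "trunc B y = min (max y (- B)) B"

definition trunc_family :: "real \<Rightarrow> ('a \<Rightarrow> real) set \<Rightarrow> ('a \<Rightarrow> real) set" where
  "trunc_family B G = (\<lambda>g x. trunc B (g x)) ` G"

definition pointwise_measurable :: "('a \<Rightarrow> real) set \<Rightarrow> bool" where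
  "pointwise_measurable G \<longleftrightarrow>
     (\<exists>G0\<subseteq>G. countable G0 \<and>
        (\<forall>g\<in>G. \<exists>s. (\<forall>i::nat. s i \<in> G0) \<and> (\<forall>x. (\<lambda>i. s i x) \<longlonglongrightarrow> g x)))"

text \<open>The Bochner integral is 0 for a non-integrable argument, so this is the usual norm
  only for square-integrable functions.\<close>

definition L2_norm :: "'a measure \<Rightarrow> ('a \<Rightarrow> real) \<Rightarrow> real" where
  "L2_norm \<mu> f = sqrt (\<integral>x. \<bar>f x\<bar>\<^sup>2 \<partial>\<mu>)"

definition \<xi> :: "real \<Rightarrow> real" where
  "\<xi> t = 1 + t"

text \<open>Tuples indexed by 1, ..., n are functions on the naturals, of which only the values on
  \<open>{1..n}\<close> matter; for the tuples counted here, extensionality (\<open>\<Pi>\<^sub>E\<close>)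
  makes distinct elements distinct tuples. The infimum of the empty set in \<^typ>\<open>enat\<close> is
  \<open>\<infinity>\<close>.\<close>

definition is_L1_cover ::
  "nat \<Rightarrow> ('a::topological_space \<Rightarrow> real) set \<Rightarrow> (nat \<Rightarrow> 'a) \<Rightarrow> real \<Rightarrow> (nat \<Rightarrow> 'a \<Rightarrow> real) set \<Rightarrow> bool"
  where
  "is_L1_cover n F x r L0 \<longleftrightarrow>
     finite L0 \<and> L0 \<subseteq> ({1..n} \<rightarrow>\<^sub>E borel_measurable borel) \<and>
     (\<forall>f\<in>F. \<exists>l\<in>L0. (1 / real n) * (\<Sum>k=1..n. \<bar>l k (x k) - f (x k)\<bar>) \<le> r)"

definition covering_number ::
  "nat \<Rightarrow> ('a::topological_space \<Rightarrow> real) set \<Rightarrow> (nat \<Rightarrow> 'a) \<Rightarrow> real \<Rightarrow> enat" where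
  "covering_number n F x r = (INF L0\<in>{L0. is_L1_cover n F x r L0}. enat (card L0))"

definition covA ::
  "nat \<Rightarrow> real \<Rightarrow> ('a::topological_space \<Rightarrow> real) set \<Rightarrow> (nat \<Rightarrow> 'a) \<Rightarrow> real \<Rightarrow> real \<Rightarrow> real \<Rightarrow> ennreal"
  where
  "covA n B G x c lam \<epsilon> =
     ennreal (2 * (c + 1) * (2 * c + 3)) *
     ennreal_of_enat (covering_number n (trunc_family B G) x
       (1 / 2 ^ 5 * (1 / B) * (1 / (lam * (c - 1) + 1)) * (1 - 1 / c) * \<epsilon>))"

definition cova ::
  "'w measure \<Rightarrow> (nat \<Rightarrow> 'w \<Rightarrow> 'a::topological_space) \<Rightarrow> nat \<Rightarrow> real \<Rightarrow> ('a \<Rightarrow> real) set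
     \<Rightarrow> real \<Rightarrow> real \<Rightarrow> real \<Rightarrow> ennreal" where
  "cova M X n B G c lam \<epsilon> = (\<integral>\<^sup>+\<omega>. covA n B G (\<lambda>k. X k \<omega>) c lam \<epsilon> \<partial>M)"

definition eps_fun :: "nat \<Rightarrow> real \<Rightarrow> real \<Rightarrow> real \<Rightarrow> real" where
  "eps_fun n B c lam =
     8 * B\<^sup>2 * (- (lam - 1) + sqrt ((lam - 1)\<^sup>2 + c * (c + 1) * lam\<^sup>2 / real n))"

definition b_fun :: "real \<Rightarrow> real \<Rightarrow> real \<Rightarrow> real" where
  "b_fun B c lam =
     1 / (2 ^ 5 * B\<^sup>2) *
     (1 / (1 / 3 * (1 - 1 / c) * (1 - 1 / lam) + (2 * lam - 1))\<^sup>2) *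
     (1 - 1 / c) ^ 3 * (1 - 1 / lam)"

text \<open>The next two lemmas show that converting \<^const>\<open>cova\<close> to a real number before taking
  its logarithm loses nothing.\<close>

lemma covering_number_trunc_bounded:
  assumes "B > 0" and "r > 0" and "n \<ge> 1"
  shows "\<exists>m. \<forall>x :: nat \<Rightarrow> 'a::topological_space. covering_number n (trunc_family B G) x r \<le> enat m"
proof -
  have "compact {-B..B}" by simp
  then obtain K where K: "finite K" "{-B..B} \<subseteq> (\<Union>t\<in>K. ball t r)"
    using \<open>r > 0\<close> unfolding compact_eq_totally_bounded by meson
  define L0 where "L0 = ({1..n} \<rightarrow>\<^sub>E (\<lambda>t (_::'a). t) ` K)"
  have fin: "finite L0" unfolding L0_def using K(1) by (intro finite_PiE) auto
  have meas: "L0 \<subseteq> ({1..n} \<rightarrow>\<^sub>E borel_measurable borel)"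
    unfolding L0_def by (intro PiE_mono) auto
  have "is_L1_cover n (trunc_family B G) x r L0" for x
    unfolding is_L1_cover_def
  proof (intro conjI ballI fin meas)
    fix f assume "f \<in> trunc_family B G"
    then have "f y \<in> {-B..B}" for y
      using \<open>B > 0\<close> by (auto simp: trunc_family_def trunc_def)
    then have "\<forall>y. \<exists>t\<in>K. dist t (f y) < r" using K(2) by fastforce
    then obtain \<tau> where \<tau>: "\<And>y. \<tau> y \<in> K" "\<And>y. dist (\<tau> y) (f y) < r" by metis
    define l where "l = (\<lambda>k\<in>{1..n}. \<lambda>_::'a. \<tau> (x k))"
    have "l \<in> L0" using \<tau>(1) by (auto simp: l_def L0_def)
    moreover have "(\<Sum>k=1..n. \<bar>l k (x k) - f (x k)\<bar>) \<le> real (card {1..n}) * r"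
      by (rule sum_bounded_above) (use \<tau>(2) in \<open>auto simp: l_def dist_real_def less_imp_le\<close>)
    ultimately show "\<exists>l\<in>L0. (1 / real n) * (\<Sum>k=1..n. \<bar>l k (x k) - f (x k)\<bar>) \<le> r"
      using \<open>n \<ge> 1\<close> by (intro bexI[of _ l]) (auto simp: field_simps)
  qed
  then have "covering_number n (trunc_family B G) x r \<le> enat (card L0)" for x
    unfolding covering_number_def by (intro INF_lower) auto
  then show ?thesis by blast
qed

lemma cova_finite:
  assumes "prob_space M" and "B > 0" and "n \<ge> 1" and "c > 1" and "lam > 1" and "\<epsilon> > 0"
  shows "cova M X n B G c lam \<epsilon> < \<infinity>"
proof -
  interpret prob_space M by fact
  let ?r = "1 / 2 ^ 5 * (1 / B) * (1 / (lam * (c - 1) + 1)) * (1 - 1 / c) * \<epsilon>"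
  have "lam * (c - 1) + 1 > 0" using assms by (intro add_pos_pos mult_pos_pos) auto
  then have "?r > 0" using assms by (intro mult_pos_pos) auto
  from covering_number_trunc_bounded[OF \<open>B > 0\<close> this \<open>n \<ge> 1\<close>]
  obtain m where m: "\<And>x. covering_number n (trunc_family B G) x ?r \<le> enat m" by blast
  have "covA n B G x c lam \<epsilon> \<le> ennreal (2 * (c + 1) * (2 * c + 3)) * of_nat m" for x
    unfolding covA_def using ennreal_of_enat_le_iff[THEN iffD2, OF m, of x]
    by (intro mult_left_mono) auto
  then have "cova M X n B G c lam \<epsilon> \<le> (\<integral>\<^sup>+_. ennreal (2 * (c + 1) * (2 * c + 3)) * of_nat m \<partial>M)"
    unfolding cova_def by (intro nn_integral_mono) auto
  also have "\<dots> < \<infinity>"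
    by (simp add: emeasure_space_1 ennreal_mult_less_top of_nat_less_top)
  finally show ?thesis .
qed

end

theory Submission
  imports Defs
begin

text \<open>
  Let \<open>Z\<^sub>k = trunc B Y\<^sub>k\<close>, \<open>W\<^sub>k = E[Z\<^sub>k | X\<^sub>k]\<close>, and let \<open>V g\<close> be the mean of \<open>E[(g (X\<^sub>k) - W\<^sub>k)\<^sup>2]\<close>. The
  difference \<open>W\<^sub>k - \<Phi>\<^sub>k (X\<^sub>k)\<close> is a conditional expectation of \<open>Z\<^sub>k - Y\<^sub>k\<close>, so passing between
  \<open>\<Phi>\<^sub>k (X\<^sub>k)\<close> and \<open>W\<^sub>k\<close> costs the truncation error, with weights \<open>\<xi> \<eta>\<close> and \<open>\<xi> (1 / \<eta>)\<close> for the
  estimator and \<open>\<xi> \<eta>'\<close> and \<open>\<xi> (1 / \<eta>')\<close> for the best approximation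
  (\<open>truncated_regression_distance\<close>). It remains to bound \<open>V ghat\<close> by
  \<open>(6 * lam - 5) * V gtilde + 6 * t\<close> with the maximum \<open>t\<close> from the claim.

  Consider the excess loss \<open>h\<^sub>g = (g - Z)\<^sup>2 - (gtilde - Z)\<^sup>2\<close> over the best element of the class. Its
  expectation is \<open>V g - V gtilde\<close> (\<open>expectation_excess\<close>), and its empirical mean is at most \<open>0\<close> at
  \<open>ghat\<close>. What is required is a bound for the deviation of the expectation of \<open>h\<^sub>g\<close> from its empirical
  mean, uniformly in \<open>g\<close>. It is obtained with the offset \<open>2 * s * E[(g - gtilde)\<^sup>2]\<close>
  subtracted (\<open>uniform_excess_deviation\<close>). The offset is harmless, because
  \<open>(g - gtilde)\<^sup>2 \<le> 2 * (g - W)\<^sup>2 + 2 * (gtilde - W)\<^sup>2\<close> turns it into a multiple of \<open>V g + V gtilde\<close>;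
  solving for \<open>V ghat\<close> gives the factor \<open>(1 + 4 * s) / (1 - 4 * s)\<close>, which is \<open>6 * lam - 5\<close> for
  the right \<open>s\<close>. It is also effective: \<open>h\<^sub>g\<^sup>2 \<le> 16 * B\<^sup>2 * (g - gtilde)\<^sup>2\<close>, so the offset
  dominates the variance of \<open>h\<^sub>g\<close>.

  The deviation bound is a Chernoff bound for the supremum. Jensen's inequality and convexity of
  \<open>exp\<close> replace, one observation at a time, the centred exponent by one with a random sign
  (\<open>offset_symmetrization\<close>). Given the sample, the supremum over the class is then replaced by a
  sum over a cover (\<open>sum_sup_exp_le_cover\<close>), and for each element of the cover the average over
  the signs is a product of factors at most \<open>1\<close>: the offset compensates the Laplace transform
  of the sign (\<open>excess_exp_balance\<close>). So the exponential moment of the supremum is at most the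
  expected covering number of the sample, up to the exponential of the covering error. Comparing
  the resulting exponent with \<^const>\<open>b_fun\<close> is elementary (\<open>deviation_exponent_ge\<close>).
\<close>

section \<open>Exponential inequalities\<close>

lemma (in prob_space) exp_expectation_le:
  assumes "integrable M f"
  shows "ennreal (exp (expectation f)) \<le> (\<integral>\<^sup>+x. ennreal (exp (f x)) \<partial>M)"
proof (cases "integrable M (\<lambda>x. exp (f x))")
  case True
  have "convex_on UNIV (\<lambda>x. exp (1 * x :: real))" by (rule convex_on_exp) simp
  then have cv: "convex_on UNIV (exp :: real \<Rightarrow> real)" by simp
  have "exp (expectation f) \<le> expectation (\<lambda>x. exp (f x))"
    by (rule jensens_inequality[where I = UNIV, OF assms _ _ True cv]) simp_all
  then have "ennreal (exp (expectation f)) \<le> ennreal (expectation (\<lambda>x. exp (f x)))"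
    by (rule ennreal_leI)
  also have "\<dots> = (\<integral>\<^sup>+x. ennreal (exp (f x)) \<partial>M)"
    using True by (intro nn_integral_eq_integral[symmetric]) simp_all
  finally show ?thesis .
next
  case False
  have f [measurable]: "f \<in> borel_measurable M" using assms by simp
  have "\<not> (\<integral>\<^sup>+x. ennreal (exp (f x)) \<partial>M) < \<infinity>"
    using False integrableI_nonneg[of "\<lambda>x. exp (f x)" M] by fastforce
  then show ?thesis by (simp add: not_less top_unique)
qed

text \<open>Hoeffding's lemma for a fair sign: its logarithmic form at success probability \<open>1 / 2\<close>
  is the statement about \<open>ln (cosh y)\<close>.\<close>
lemma cosh_le_exp_square: "cosh x \<le> exp (x\<^sup>2 / 2)" for x :: real
proof -
  have *: "cosh y \<le> exp (y\<^sup>2 / 2)" if "y \<ge> 0" for y :: real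
  proof -
    have "1 + 1 / 2 * (exp (2 * y) - 1) = exp y * cosh y"
      by (simp add: cosh_field_def exp_minus field_simps flip: exp_add)
    then have "ln (cosh y) = - (2 * y) * (1 / 2) + ln (1 + 1 / 2 * (exp (2 * y) - 1))"
      by (simp add: ln_mult)
    also have "\<dots> \<le> (2 * y)\<^sup>2 / 8"
      using Hoeffdings_lemma_aux[of "2 * y" "1 / 2"] that by simp
    finally have "ln (cosh y) \<le> y\<^sup>2 / 2" by (simp add: power2_eq_square)
    then have "exp (ln (cosh y)) \<le> exp (y\<^sup>2 / 2)" by (subst exp_le_cancel_iff)
    then show ?thesis by (subst (asm) exp_ln) (simp_all add: cosh_real_pos)
  qed
  show ?thesis
    using *[of x] *[of "- x"] by (cases "x \<ge> 0") simp_all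
qed
text \<open>Averaging \<open>exp\<close> over a random choice of \<open>u\<close> and \<open>v\<close> gives
  \<open>exp ((u + v) / 2) * cosh ((u - v) / 2)\<close>; a sufficiently negative mean compensates the
  factor \<open>cosh\<close>. This is how a negative quadratic offset absorbs the fluctuation of a
  random sign.\<close>
lemma sum_exp_le_2:
  fixes u v :: real
  assumes "(u - v)\<^sup>2 \<le> - 4 * (u + v)"
  shows "exp u + exp v \<le> 2"
proof -
  define p where "p = (u + v) / 2"
  define q where "q = (u - v) / 2"
  have uv: "u = p + q" "v = p - q" by (simp_all add: p_def q_def field_simps)
  have "exp u + exp v = 2 * (exp p * cosh q)"
    by (simp add: uv exp_add exp_diff exp_minus cosh_field_def field_simps)
  also have "\<dots> \<le> 2 * (exp p * exp (q\<^sup>2 / 2))"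
    by (intro mult_left_mono cosh_le_exp_square) auto
  also have "\<dots> = 2 * exp (p + q\<^sup>2 / 2)"
    by (simp add: exp_add)
  also have "\<dots> \<le> 2 * exp 0"
  proof -
    have "q\<^sup>2 = (u - v)\<^sup>2 / 4" by (simp add: q_def power_divide)
    then have "p + q\<^sup>2 / 2 \<le> 0" using assms unfolding p_def by argo
    then show ?thesis by simp
  qed
  finally show ?thesis by simp
qed

section \<open>Symmetrization with an offset\<close>

text \<open>The exponential of a supremum over \<open>T\<close>. Taking the supremum in
  \<^typ>\<open>ennreal\<close> after exponentiating spares all boundedness conditions, and a
  countable \<open>T\<close> keeps it measurable.\<close>

definition sup_exp :: "'t set \<Rightarrow> ('t \<Rightarrow> real) \<Rightarrow> ennreal" where
  "sup_exp T a = (SUP t\<in>T. ennreal (exp (a t)))"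

lemma sup_exp_measurable [measurable (raw)]:
  assumes "countable T" "\<And>t. t \<in> T \<Longrightarrow> (\<lambda>x. a x t) \<in> borel_measurable N"
  shows "(\<lambda>x. sup_exp T (a x)) \<in> borel_measurable N"
  unfolding sup_exp_def using assms by (intro borel_measurable_SUP) auto

lemma sup_exp_upper: "t \<in> T \<Longrightarrow> ennreal (exp (a t)) \<le> sup_exp T a"
  unfolding sup_exp_def by (rule SUP_upper)

lemma sup_exp_le: "(\<And>t. t \<in> T \<Longrightarrow> ennreal (exp (a t)) \<le> C) \<Longrightarrow> sup_exp T a \<le> C"
  unfolding sup_exp_def by (rule SUP_least)

text \<open>Convexity of \<open>exp\<close>, uniformly in the index: the \<open>b\<close>-half of the exponent is
  replaced by a constant and only the \<open>d\<close>-half keeps its supremum.\<close>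
lemma two_times_sup_exp_le:
  assumes "\<And>t. t \<in> T \<Longrightarrow> ennreal (exp (b t)) \<le> C" "\<And>t. t \<in> T \<Longrightarrow> 2 * a t = b t + d t"
  shows "2 * sup_exp T a \<le> C + sup_exp T d"
proof -
  have "2 * ennreal (exp (a t)) \<le> C + sup_exp T d" if t: "t \<in> T" for t
  proof -
    have "0 \<le> (exp (b t / 2) - exp (d t / 2))\<^sup>2" by simp
    moreover have "exp (b t) = exp (b t / 2) * exp (b t / 2)" "exp (d t) = exp (d t / 2) * exp (d t / 2)"
      by (simp_all flip: exp_add)
    ultimately have "2 * exp (b t / 2 + d t / 2) \<le> exp (b t) + exp (d t)"
      by (simp add: power2_eq_square exp_add left_diff_distrib right_diff_distrib mult.commute)
    moreover have "a t = b t / 2 + d t / 2" using assms(2)[OF t] by simp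
    ultimately have "2 * exp (a t) \<le> exp (b t) + exp (d t)" by simp
    then have "ennreal (2 * exp (a t)) \<le> ennreal (exp (b t) + exp (d t))"
      by (rule ennreal_leI)
    then have "2 * ennreal (exp (a t)) \<le> ennreal (exp (b t)) + ennreal (exp (d t))"
      by (simp add: ennreal_mult)
    also have "\<dots> \<le> C + sup_exp T d"
      by (intro add_mono assms(1) sup_exp_upper t)
    finally show ?thesis .
  qed
  then show ?thesis
    unfolding sup_exp_def[of T a] SUP_mult_left_ennreal by (intro SUP_least) auto
qed

text \<open>Symmetrization of one observation. Jensen's inequality turns the expectation
  \<open>expectation (p t)\<close> into an average over a second copy of the observation, and convexity of
  \<open>exp\<close> then separates the two copies. Since they end up in different summands, both are
  integrated against the same measure and the copy disappears.\<close>
lemma (in prob_space) symmetrization_single_coordinate: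
  assumes T: "countable T"
    and p: "\<And>t. t \<in> T \<Longrightarrow> integrable M (p t)"
    and m: "\<And>t. t \<in> T \<Longrightarrow> m t \<in> borel_measurable M"
  shows "2 * (\<integral>\<^sup>+x. sup_exp T (\<lambda>t. a t + (expectation (p t) + m t x)) \<partial>M)
    \<le> (\<integral>\<^sup>+x. sup_exp T (\<lambda>t. a t + 2 * p t x) + sup_exp T (\<lambda>t. a t + 2 * m t x) \<partial>M)"
proof -
  have p_meas: "\<And>t. t \<in> T \<Longrightarrow> p t \<in> borel_measurable M" using p by auto
  note [measurable] = T p_meas m
  let ?P = "\<integral>\<^sup>+x. sup_exp T (\<lambda>t. a t + 2 * p t x) \<partial>M"
  have P: "ennreal (exp (a t + 2 * expectation (p t))) \<le> ?P" if t: "t \<in> T" for t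
  proof -
    have "ennreal (exp (expectation (\<lambda>x. a t + 2 * p t x)))
        \<le> (\<integral>\<^sup>+x. ennreal (exp (a t + 2 * p t x)) \<partial>M)"
      using p[OF t] by (intro exp_expectation_le) auto
    also have "\<dots> \<le> ?P"
      by (intro nn_integral_mono sup_exp_upper[OF t, where a = "\<lambda>t. a t + 2 * p t _"])
    finally show ?thesis using p[OF t] by (simp add: prob_space)
  qed
  have "2 * (\<integral>\<^sup>+x. sup_exp T (\<lambda>t. a t + (expectation (p t) + m t x)) \<partial>M)
      = (\<integral>\<^sup>+x. 2 * sup_exp T (\<lambda>t. a t + (expectation (p t) + m t x)) \<partial>M)"
    by (subst nn_integral_cmult) auto
  also have "\<dots> \<le> (\<integral>\<^sup>+x. ?P + sup_exp T (\<lambda>t. a t + 2 * m t x) \<partial>M)"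
    by (intro nn_integral_mono two_times_sup_exp_le[OF P]) auto
  also have "\<dots> = ?P + (\<integral>\<^sup>+x. sup_exp T (\<lambda>t. a t + 2 * m t x) \<partial>M)"
    by (subst nn_integral_add) (auto simp: emeasure_space_1)
  also have "\<dots> = (\<integral>\<^sup>+x. sup_exp T (\<lambda>t. a t + 2 * p t x) + sup_exp T (\<lambda>t. a t + 2 * m t x) \<partial>M)"
    by (subst nn_integral_add) auto
  finally show ?thesis .
qed

text \<open>Independent observations are symmetrized one after the other. A subset \<open>I\<close> of \<open>J\<close>
  records the coordinates that carry the sign \<open>p\<close>; so the sum over \<open>Pow J\<close>, divided by
  \<open>2 ^ card J\<close>, is the average over independent fair signs. The deterministic part \<open>a\<close> of the
  exponent is arbitrary because the coordinates already treated are moved into it.\<close>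
lemma offset_symmetrization:
  fixes \<mu> :: "'k \<Rightarrow> 's measure"
  assumes \<mu>: "\<And>k. prob_space (\<mu> k)"
    and J: "finite J" and T: "countable T"
    and p: "\<And>k t. t \<in> T \<Longrightarrow> integrable (\<mu> k) (p t)"
    and m: "\<And>k t. t \<in> T \<Longrightarrow> m t \<in> borel_measurable (\<mu> k)"
  shows "2 ^ card J *
      (\<integral>\<^sup>+x. sup_exp T (\<lambda>t. a t + (\<Sum>k\<in>J. (\<integral>y. p t y \<partial>\<mu> k) + m t (x k))) \<partial>PiM J \<mu>)
    \<le> (\<integral>\<^sup>+x. (\<Sum>I\<in>Pow J. sup_exp T
          (\<lambda>t. a t + (\<Sum>k\<in>J. 2 * (if k \<in> I then p t (x k) else m t (x k))))) \<partial>PiM J \<mu>)"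
  using J
proof (induction J arbitrary: a)
  case empty
  interpret prob_space "PiM {} \<mu>" by (rule prob_space_PiM) (rule \<mu>)
  show ?case by (simp add: sup_exp_def)
next
  case (insert k J)
  interpret product_prob_space \<mu> by (simp add: product_prob_spaceI \<mu>)
  interpret J: prob_space "PiM J \<mu>" by (rule prob_space_PiM) (rule \<mu>)
  have p_meas [measurable]: "\<And>k t. t \<in> T \<Longrightarrow> p t \<in> borel_measurable (\<mu> k)" using p by auto
  note [measurable] = T m
  note ins = product_nn_integral_insert[OF insert(1,2)] product_nn_integral_insert_rev[OF insert(1,2)]
  let ?A = "\<lambda>t y. (\<integral>z. p t z \<partial>\<mu> k) + m t y"
  let ?L = "\<lambda>J x t. a t + (\<Sum>k\<in>J. (\<integral>y. p t y \<partial>\<mu> k) + m t (x k))"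
  let ?R = "\<lambda>J I x t. \<Sum>k\<in>J. 2 * (if k \<in> I then p t (x k) else m t (x k))"
  have upd: "?R J I (x(k := y)) t = ?R J I x t" for I x y t
    using insert(2) by (intro sum.cong) auto
  have updL: "(\<Sum>i\<in>J. (\<integral>y. p t y \<partial>\<mu> i) + m t ((x(k := y)) i)) = (\<Sum>i\<in>J. (\<integral>y. p t y \<partial>\<mu> i) + m t (x i))"
    for x y t
    using insert(2) by (intro sum.cong) auto
  \<comment> \<open>The coordinates in \<open>J\<close> are symmetrized in \<open>F\<close>, all coordinates in \<open>G\<close>.\<close>
  define F where "F z = (\<Sum>I\<in>Pow J. sup_exp T (\<lambda>t. a t + ?A t (z k) + ?R J I z t))" for z
  have F_meas: "F \<in> borel_measurable (PiM (insert k J) \<mu>)"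
    unfolding F_def by measurable
  define G where "G z = (\<Sum>I\<in>Pow (insert k J). sup_exp T (\<lambda>t. a t + ?R (insert k J) I z t))" for z
  have G_meas: "G \<in> borel_measurable (PiM (insert k J) \<mu>)"
    unfolding G_def by measurable
  have L_meas: "(\<lambda>x. sup_exp T (?L (insert k J) x)) \<in> borel_measurable (PiM (insert k J) \<mu>)"
    by measurable
  have F_upd: "F (x(k := y)) = (\<Sum>I\<in>Pow J. sup_exp T (\<lambda>t. (a t + ?R J I x t) + ?A t y))" for x y
    unfolding F_def upd by (simp add: algebra_simps)
  have G_upd: "G (x(k := y)) = (\<Sum>I\<in>Pow J. sup_exp T (\<lambda>t. (a t + ?R J I x t) + 2 * p t y)
      + sup_exp T (\<lambda>t. (a t + ?R J I x t) + 2 * m t y))" for x y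
  proof -
    have "inj_on (insert k) (Pow J)" "Pow J \<inter> insert k ` Pow J = {}"
      using insert(2) by (auto simp: inj_on_def)
    then have "G (x(k := y)) = (\<Sum>I\<in>Pow J. sup_exp T (\<lambda>t. a t + ?R (insert k J) I (x(k := y)) t)
      + sup_exp T (\<lambda>t. a t + ?R (insert k J) (insert k I) (x(k := y)) t))"
      unfolding G_def Pow_insert using insert(1)
      by (subst sum.union_disjoint) (auto simp: sum.reindex sum.distrib)
    also have "\<dots> = (\<Sum>I\<in>Pow J. sup_exp T (\<lambda>t. (a t + ?R J I x t) + 2 * m t y)
      + sup_exp T (\<lambda>t. (a t + ?R J I x t) + 2 * p t y))"
    proof (rule sum.cong)
      fix I assume I: "I \<in> Pow J"
      have "?R J (insert k I) (x(k := y)) t = ?R J I x t" for t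
        using insert(2) by (intro sum.cong) auto
      then have 1: "a t + ?R (insert k J) (insert k I) (x(k := y)) t = a t + ?R J I x t + 2 * p t y" for t
        using insert(1,2) by simp
      have 2: "a t + ?R (insert k J) I (x(k := y)) t = a t + ?R J I x t + 2 * m t y" for t
      proof -
        have "k \<notin> I" using I insert(2) by auto
        then show ?thesis
          unfolding sum.insert[OF insert(1,2)] upd by simp
      qed
      show "sup_exp T (\<lambda>t. a t + ?R (insert k J) I (x(k := y)) t)
          + sup_exp T (\<lambda>t. a t + ?R (insert k J) (insert k I) (x(k := y)) t)
        = sup_exp T (\<lambda>t. (a t + ?R J I x t) + 2 * m t y)
          + sup_exp T (\<lambda>t. (a t + ?R J I x t) + 2 * p t y)"
        unfolding 1 2 ..
    qed simp
    finally show ?thesis by (simp add: add.commute)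
  qed
  have "2 ^ card (insert k J) * (\<integral>\<^sup>+x. sup_exp T (?L (insert k J) x) \<partial>PiM (insert k J) \<mu>)
      = 2 * (\<integral>\<^sup>+y. 2 ^ card J * (\<integral>\<^sup>+x. sup_exp T (\<lambda>t. (a t + ?A t y)
          + (\<Sum>k\<in>J. (\<integral>y. p t y \<partial>\<mu> k) + m t (x k))) \<partial>PiM J \<mu>) \<partial>\<mu> k)"
  proof -
    have L_upd: "?L (insert k J) (x(k := y)) t
        = (a t + ?A t y) + (\<Sum>k\<in>J. (\<integral>y. p t y \<partial>\<mu> k) + m t (x k))" for x y t
      unfolding sum.insert[OF insert(1,2)] updL by simp
    show ?thesis
      unfolding ins(2)[OF L_meas] L_upd using insert(1,2)
      by (subst nn_integral_cmult) (auto simp: mult.assoc)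
  qed
  also have "\<dots> \<le> 2 * (\<integral>\<^sup>+y. (\<integral>\<^sup>+x. (\<Sum>I\<in>Pow J. sup_exp T (\<lambda>t. (a t + ?A t y) + ?R J I x t))
      \<partial>PiM J \<mu>) \<partial>\<mu> k)"
    by (intro mult_left_mono nn_integral_mono insert.IH) auto
  also have "\<dots> = 2 * (\<integral>\<^sup>+y. (\<integral>\<^sup>+x. F (x(k := y)) \<partial>PiM J \<mu>) \<partial>\<mu> k)"
    unfolding F_upd by (simp only: add.assoc add.commute add.left_commute)
  \<comment> \<open>The induction hypothesis integrates over \<open>J\<close> first, the treatment of \<open>k\<close> integrates over \<open>k\<close> first.\<close>
  also have "\<dots> = 2 * (\<integral>\<^sup>+x. (\<integral>\<^sup>+y. F (x(k := y)) \<partial>\<mu> k) \<partial>PiM J \<mu>)"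
    by (simp only: ins(1)[OF F_meas, symmetric] ins(2)[OF F_meas, symmetric])
  also have "\<dots> = (\<integral>\<^sup>+x. (\<Sum>I\<in>Pow J. 2 * (\<integral>\<^sup>+y. sup_exp T (\<lambda>t. (a t + ?R J I x t) + ?A t y) \<partial>\<mu> k))
      \<partial>PiM J \<mu>)"
  proof -
    have "(\<integral>\<^sup>+y. F (x(k := y)) \<partial>\<mu> k)
        = (\<Sum>I\<in>Pow J. \<integral>\<^sup>+y. sup_exp T (\<lambda>t. (a t + ?R J I x t) + ?A t y) \<partial>\<mu> k)" for x
      unfolding F_upd by (subst nn_integral_sum) auto
    then show ?thesis
      by (subst nn_integral_cmult[symmetric]) (auto simp: sum_distrib_left)
  qed
  also have "\<dots> \<le> (\<integral>\<^sup>+x. (\<Sum>I\<in>Pow J. (\<integral>\<^sup>+y. sup_exp T (\<lambda>t. (a t + ?R J I x t) + 2 * p t y)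
      + sup_exp T (\<lambda>t. (a t + ?R J I x t) + 2 * m t y) \<partial>\<mu> k)) \<partial>PiM J \<mu>)"
    by (intro nn_integral_mono sum_mono prob_space.symmetrization_single_coordinate \<mu> T p m)
  also have "\<dots> = (\<integral>\<^sup>+x. (\<integral>\<^sup>+y. G (x(k := y)) \<partial>\<mu> k) \<partial>PiM J \<mu>)"
    unfolding G_upd by (subst nn_integral_sum) auto
  also have "\<dots> = (\<integral>\<^sup>+x. G x \<partial>PiM (insert k J) \<mu>)"
    by (rule ins(1)[OF G_meas, symmetric])
  finally show ?case unfolding G_def .
qed

section \<open>The excess loss\<close>

text \<open>The squared loss of a prediction \<open>v\<close> of the response \<open>z\<close>, relative to a reference
  prediction \<open>w\<close>. It equals \<open>(v - w) * (v + w - 2 * z)\<close> and so is small where \<open>v\<close> is close to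
  \<open>w\<close>, even if \<open>z\<close> is not.\<close>

definition excess :: "real \<Rightarrow> real \<Rightarrow> real \<Rightarrow> real" where
  "excess z w v = (v - z)\<^sup>2 - (w - z)\<^sup>2"

lemma abs_trunc_le: "B > 0 \<Longrightarrow> \<bar>trunc B y\<bar> \<le> B"
  by (auto simp: trunc_def)

lemma trunc_eq: "\<bar>y\<bar> \<le> B \<Longrightarrow> trunc B y = y"
  by (auto simp: trunc_def)

lemma abs_trunc_diff_le: "\<bar>b\<bar> \<le> B \<Longrightarrow> \<bar>b - trunc B a\<bar> \<le> \<bar>a - b\<bar>"
  by (auto simp: trunc_def)

text \<open>The exponents \<open>2 * (h - 2 * s * q)\<close> and \<open>- 2 * h\<close>, scaled by \<open>\<theta>\<close>, with excess loss
  \<open>h\<close> and \<open>q = (v - w)\<^sup>2\<close>, have sum \<open>- 4 * s * q\<close> and difference \<open>4 * (h - s * q)\<close>. Here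
  \<open>h - s * q\<close> is \<open>v - w\<close> times a factor of size at most \<open>4 * B\<close>, so its square is at most
  \<open>16 * B\<^sup>2 * q\<close>. The condition \<open>16 * B\<^sup>2 * \<theta> = s\<close> is the balance that makes the
  offset win in \<open>sum_exp_le_2\<close>.\<close>
lemma excess_exp_balance:
  assumes "\<bar>z\<bar> \<le> B" "\<bar>w\<bar> \<le> B" "\<bar>v\<bar> \<le> B" "0 \<le> \<theta>" "0 \<le> s" "s \<le> 1" "16 * B\<^sup>2 * \<theta> = s"
  shows "exp (2 * (\<theta> * (excess z w v - 2 * s * (v - w)\<^sup>2))) + exp (2 * (- \<theta> * excess z w v)) \<le> 2"
proof (rule sum_exp_le_2)
  let ?h = "excess z w v" and ?q = "(v - w)\<^sup>2"
  define c where "c = (1 - s) * (v - z) + (1 + s) * (w - z)"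
  have "\<bar>c\<bar> \<le> (1 - s) * (2 * B) + (1 + s) * (2 * B)"
    unfolding c_def using assms
    by (intro order_trans[OF abs_triangle_ineq] add_mono) (auto simp: abs_mult intro!: mult_left_mono)
  then have "c\<^sup>2 \<le> (4 * B)\<^sup>2"
    by (intro abs_le_square_iff[THEN iffD1]) (auto simp: algebra_simps)
  then have "\<theta> * (?q * c\<^sup>2) \<le> \<theta> * (?q * (4 * B)\<^sup>2)"
    using assms by (intro mult_left_mono) auto
  also have "\<dots> = (16 * B\<^sup>2 * \<theta>) * ?q" by (simp add: power2_eq_square)
  also have "\<dots> = s * ?q" unfolding assms(7) ..
  finally have *: "\<theta> * (?q * c\<^sup>2) \<le> s * ?q" .
  have "?h - s * ?q = (v - w) * c"
    unfolding excess_def c_def by algebra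
  then have "(?h - s * ?q)\<^sup>2 = ?q * c\<^sup>2" by (simp add: power_mult_distrib)
  then have **: "16 * \<theta> * (\<theta> * (?h - s * ?q)\<^sup>2) \<le> 16 * \<theta> * (s * ?q)"
    using * assms by (intro mult_left_mono) auto
  have "(2 * (\<theta> * (?h - 2 * s * ?q)) - 2 * (- \<theta> * ?h))\<^sup>2 = 16 * \<theta> * (\<theta> * (?h - s * ?q)\<^sup>2)"
    by algebra
  also note **
  also have "16 * \<theta> * (s * ?q) = - 4 * (2 * (\<theta> * (?h - 2 * s * ?q)) + 2 * (- \<theta> * ?h))"
    by algebra
  finally show "(2 * (\<theta> * (?h - 2 * s * ?q)) - 2 * (- \<theta> * ?h))\<^sup>2
    \<le> - 4 * (2 * (\<theta> * (?h - 2 * s * ?q)) + 2 * (- \<theta> * ?h))" .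
qed

text \<open>The difference factors through \<open>v - v'\<close>; for \<open>s \<le> 1 / 2\<close> the absolute
  values of the coefficients in the cofactor add up to \<open>4\<close>, the same as without offset.\<close>
lemma excess_lipschitz:
  assumes "\<bar>z\<bar> \<le> B" "\<bar>w\<bar> \<le> B" "\<bar>v\<bar> \<le> B" "\<bar>v'\<bar> \<le> B" "0 \<le> s" "s \<le> 1 / 2"
  shows "\<bar>(excess z w v - 2 * s * (v - w)\<^sup>2) - (excess z w v' - 2 * s * (v' - w)\<^sup>2)\<bar> \<le> 4 * B * \<bar>v - v'\<bar>"
proof -
  define c where "c = (1 - 2 * s) * (v + v') + ((4 * s) * w - 2 * z)"
  have "\<bar>c\<bar> \<le> (1 - 2 * s) * (2 * B) + ((4 * s) * B + 2 * B)"
  proof -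
    have "\<bar>(1 - 2 * s) * (v + v')\<bar> \<le> (1 - 2 * s) * (2 * B)"
      using assms by (auto simp: abs_mult intro!: mult_left_mono)
    moreover have "\<bar>(4 * s) * w\<bar> \<le> (4 * s) * B"
      using assms unfolding abs_mult by (intro mult_mono) auto
    ultimately show ?thesis unfolding c_def using assms by linarith
  qed
  then have "\<bar>c\<bar> \<le> 4 * B" by (simp add: algebra_simps)
  have "(excess z w v - 2 * s * (v - w)\<^sup>2) - (excess z w v' - 2 * s * (v' - w)\<^sup>2) = c * (v - v')"
    unfolding excess_def c_def by algebra
  then show ?thesis
    using \<open>\<bar>c\<bar> \<le> 4 * B\<close> by (simp add: abs_mult mult_right_mono)
qed

section \<open>Covering numbers\<close>

text \<open>For a fixed sample, every \<open>v t\<close> is replaced by its neighbour in the cover, at the price of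
  the factor \<open>exp (C * \<rho>)\<close>. For a single element of the cover, the sum over all
  sign patterns is a product over the coordinates, and each factor is at most \<open>2\<close> by
  assumption. So the supremum costs only the number of elements of the cover.\<close>

lemma sum_sup_exp_le_cover:
  fixes P Q :: "'k \<Rightarrow> real \<Rightarrow> real" and v :: "'t \<Rightarrow> 'k \<Rightarrow> real" and L0 :: "('k \<Rightarrow> real) set"
  assumes J: "finite J" and L0: "finite L0"
    and cover: "\<And>t. t \<in> T \<Longrightarrow> \<exists>l\<in>L0. (\<Sum>k\<in>J. \<bar>v t k - l k\<bar>) \<le> \<rho>"
    and v: "\<And>t k. t \<in> T \<Longrightarrow> k \<in> J \<Longrightarrow> v t k \<in> V"
    and l: "\<And>l k. l \<in> L0 \<Longrightarrow> k \<in> J \<Longrightarrow> l k \<in> V"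
    and P: "\<And>k x y. k \<in> J \<Longrightarrow> x \<in> V \<Longrightarrow> y \<in> V \<Longrightarrow> \<bar>P k x - P k y\<bar> \<le> C * \<bar>x - y\<bar>"
    and Q: "\<And>k x y. k \<in> J \<Longrightarrow> x \<in> V \<Longrightarrow> y \<in> V \<Longrightarrow> \<bar>Q k x - Q k y\<bar> \<le> C * \<bar>x - y\<bar>"
    and PQ: "\<And>k x. k \<in> J \<Longrightarrow> x \<in> V \<Longrightarrow> exp (P k x) + exp (Q k x) \<le> 2"
    and C: "C \<ge> 0"
  shows "(\<Sum>I\<in>Pow J. sup_exp T (\<lambda>t. \<Sum>k\<in>J. if k \<in> I then P k (v t k) else Q k (v t k)))
    \<le> ennreal (2 ^ card J * exp (C * \<rho>) * real (card L0))"
proof -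
  let ?S = "\<lambda>I w. \<Sum>k\<in>J. if k \<in> I then P k (w k) else Q k (w k)"
  have one: "sup_exp T (\<lambda>t. ?S I (v t)) \<le> ennreal (exp (C * \<rho>) * (\<Sum>l\<in>L0. exp (?S I l)))" for I
  proof (rule sup_exp_le)
    fix t assume t: "t \<in> T"
    from cover[OF t] obtain l where l0: "l \<in> L0" "(\<Sum>k\<in>J. \<bar>v t k - l k\<bar>) \<le> \<rho>" by blast
    have "?S I (v t) - ?S I l \<le> (\<Sum>k\<in>J. C * \<bar>v t k - l k\<bar>)"
      unfolding sum_subtractf[symmetric]
    proof (rule sum_mono)
      fix k assume k: "k \<in> J"
      show "(if k \<in> I then P k (v t k) else Q k (v t k)) - (if k \<in> I then P k (l k) else Q k (l k))
        \<le> C * \<bar>v t k - l k\<bar>"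
        using P[OF k v[OF t k] l[OF l0(1) k]] Q[OF k v[OF t k] l[OF l0(1) k]] by auto
    qed
    also have "\<dots> \<le> C * \<rho>"
      unfolding sum_distrib_left[symmetric] using l0(2) C by (rule mult_left_mono)
    finally have "exp (?S I (v t)) \<le> exp (C * \<rho> + ?S I l)" by simp
    also have "\<dots> \<le> exp (C * \<rho>) * (\<Sum>l\<in>L0. exp (?S I l))"
      unfolding exp_add using L0 l0(1)
      by (intro mult_left_mono member_le_sum[where f = "\<lambda>l. exp (?S I l)"]) auto
    finally show "ennreal (exp (?S I (v t))) \<le> ennreal (exp (C * \<rho>) * (\<Sum>l\<in>L0. exp (?S I l)))"
      by (rule ennreal_leI)
  qed
  have sign_average: "(\<Sum>I\<in>Pow J. exp (?S I l)) \<le> 2 ^ card J" if "l \<in> L0" for l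
  proof -
    have "(\<Sum>I\<in>Pow J. exp (?S I l)) = (\<Sum>I\<in>Pow J. (\<Prod>k\<in>I. exp (P k (l k))) * (\<Prod>k\<in>J - I. exp (Q k (l k))))"
    proof (rule sum.cong)
      fix I assume "I \<in> Pow J"
      then have I: "I \<subseteq> J" by simp
      have "?S I l = (\<Sum>k\<in>I. P k (l k)) + (\<Sum>k\<in>J - I. Q k (l k))"
        using J I by (simp add: sum.If_cases Int_absorb1 Diff_eq)
      then show "exp (?S I l) = (\<Prod>k\<in>I. exp (P k (l k))) * (\<Prod>k\<in>J - I. exp (Q k (l k)))"
        using J I by (simp add: exp_add exp_sum finite_subset)
    qed simp
    also have "\<dots> = (\<Prod>k\<in>J. exp (P k (l k)) + exp (Q k (l k)))"
      using J by (rule prod_add[symmetric])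
    also have "\<dots> \<le> (\<Prod>k\<in>J. 2)"
      using PQ l that by (intro prod_mono) (auto intro: add_nonneg_nonneg)
    finally show ?thesis by simp
  qed
  have "(\<Sum>I\<in>Pow J. sup_exp T (\<lambda>t. ?S I (v t)))
      \<le> (\<Sum>I\<in>Pow J. ennreal (exp (C * \<rho>) * (\<Sum>l\<in>L0. exp (?S I l))))"
    by (intro sum_mono one)
  also have "\<dots> = ennreal (\<Sum>I\<in>Pow J. exp (C * \<rho>) * (\<Sum>l\<in>L0. exp (?S I l)))"
    by (intro sum_ennreal) (auto intro!: mult_nonneg_nonneg sum_nonneg)
  also have "(\<Sum>I\<in>Pow J. exp (C * \<rho>) * (\<Sum>l\<in>L0. exp (?S I l)))
      = exp (C * \<rho>) * (\<Sum>l\<in>L0. \<Sum>I\<in>Pow J. exp (?S I l))"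
    unfolding sum_distrib_left[symmetric] by (subst sum.swap) simp
  also have "\<dots> \<le> exp (C * \<rho>) * (\<Sum>l\<in>L0. 2 ^ card J)"
    by (intro mult_left_mono sum_mono sign_average) auto
  also have "\<dots> = 2 ^ card J * exp (C * \<rho>) * real (card L0)" by simp
  finally show ?thesis by (simp add: ennreal_leI)
qed

text \<open>The infimum in the definition of the covering number is attained as soon as some cover
  exists.\<close>
lemma le_covering_number:
  fixes F :: "('a::topological_space \<Rightarrow> real) set"
  assumes C: "C \<ge> 0"
    and le: "\<And>L0. is_L1_cover n F x r L0 \<Longrightarrow> a \<le> ennreal (C * real (card L0))"
    and ex: "\<exists>m. covering_number n F x r \<le> enat m"
  shows "a \<le> ennreal C * ennreal_of_enat (covering_number n F x r)"
proof -
  have "{L0. is_L1_cover n F x r L0} \<noteq> {}"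
  proof
    assume empty: "{L0. is_L1_cover n F x r L0} = {}"
    have "covering_number n F x r = \<infinity>"
      unfolding covering_number_def empty by (simp add: top_enat_def)
    then show False using ex by simp
  qed
  then obtain L1 where "is_L1_cover n F x r L1" by auto
  then have "covering_number n F x r \<in> (\<lambda>L0. enat (card L0)) ` {L0. is_L1_cover n F x r L0}"
    unfolding covering_number_def by (intro wellorder_InfI[of "enat (card L1)"]) auto
  then obtain L0 where L0: "is_L1_cover n F x r L0" "covering_number n F x r = enat (card L0)"
    by auto
  have "a \<le> ennreal (C * real (card L0))" by (rule le[OF L0(1)])
  also have "\<dots> = ennreal C * ennreal_of_enat (covering_number n F x r)"
    using C by (simp add: L0(2) ennreal_mult ennreal_of_nat_eq_real_of_nat)
  finally show ?thesis .
qed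

text \<open>The nonnegative integral is the supremum over the simple functions below the integrand;
  this makes the inequality hold for every \<open>g\<close>, in particular for the covering number as a
  function of a random sample.\<close>
lemma nn_integral_le_cmult:
  assumes f: "f \<in> borel_measurable M" and c: "c > 0"
    and le: "\<And>x. x \<in> space M \<Longrightarrow> f x \<le> ennreal c * g x"
  shows "(\<integral>\<^sup>+x. f x \<partial>M) \<le> ennreal c * (\<integral>\<^sup>+x. g x \<partial>M)"
proof -
  have inv: "ennreal c * ennreal (1 / c) = 1"
    using c by (simp add: ennreal_mult[symmetric])
  have "(\<integral>\<^sup>+x. f x \<partial>M) = ennreal c * (ennreal (1 / c) * (\<integral>\<^sup>+x. f x \<partial>M))"
    by (simp add: mult.assoc[symmetric] inv)
  also have "\<dots> = ennreal c * (\<integral>\<^sup>+x. ennreal (1 / c) * f x \<partial>M)"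
    using f by (subst nn_integral_cmult) auto
  also have "\<dots> \<le> ennreal c * (\<integral>\<^sup>+x. g x \<partial>M)"
  proof (intro mult_left_mono nn_integral_mono)
    fix x assume "x \<in> space M"
    from le[OF this] have "ennreal (1 / c) * f x \<le> ennreal (1 / c) * (ennreal c * g x)"
      by (rule mult_left_mono) simp
    also have "\<dots> = g x"
      using inv by (simp add: mult.assoc[symmetric] mult.commute)
    finally show "ennreal (1 / c) * f x \<le> g x" .
  qed simp
  finally show ?thesis .
qed

text \<open>Truncation at level \<open>B\<close> moves the elements of a cover into the range of \<open>G\<close> without
  increasing distances to \<open>G\<close>. So the local estimates of the excess loss apply to them.\<close>
lemma sup_exp_signs_le_covering_number:
  fixes G :: "('a::topological_space \<Rightarrow> real) set" and x :: "nat \<Rightarrow> 'a" and z :: "nat \<Rightarrow> real"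
  assumes n: "n \<ge> 1" and B: "B > 0" and G: "\<And>g x. g \<in> G \<Longrightarrow> \<bar>g x\<bar> \<le> B"
    and w: "\<And>x. \<bar>w x\<bar> \<le> B" and z: "\<And>k. \<bar>z k\<bar> \<le> B"
    and s: "0 < s" "s \<le> 1 / 2" "16 * B\<^sup>2 * \<theta> = s" and r: "r > 0"
    and T: "T \<subseteq> G"
  shows "(\<Sum>I\<in>Pow {1..n}. sup_exp T (\<lambda>g. \<Sum>k\<in>{1..n}. 2 * (if k \<in> I
        then \<theta> * (excess (z k) (w (x k)) (g (x k)) - 2 * s * (g (x k) - w (x k))\<^sup>2)
        else - \<theta> * excess (z k) (w (x k)) (g (x k)))))
    \<le> ennreal (2 ^ n * exp (8 * \<theta> * B * real n * r))
        * ennreal_of_enat (covering_number n (trunc_family B G) x r)" (is "?lhs \<le> _")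
proof (rule le_covering_number)
  show "\<exists>m. covering_number n (trunc_family B G) x r \<le> enat m"
    using covering_number_trunc_bounded[OF B r n] by blast
  fix L0 assume "is_L1_cover n (trunc_family B G) x r L0"
  then have fin: "finite L0"
    and cov: "\<And>f. f \<in> trunc_family B G \<Longrightarrow>
      \<exists>l\<in>L0. (1 / real n) * (\<Sum>k=1..n. \<bar>l k (x k) - f (x k)\<bar>) \<le> r"
    by (auto simp: is_L1_cover_def)
  have \<theta>: "\<theta> \<ge> 0" using s B by (auto simp: zero_less_mult_iff dest!: sym[of _ s])
  let ?P = "\<lambda>k v. 2 * (\<theta> * (excess (z k) (w (x k)) v - 2 * s * (v - w (x k))\<^sup>2))"
  let ?Q = "\<lambda>k v. 2 * (- \<theta> * excess (z k) (w (x k)) v)"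
  define L1 where "L1 = (\<lambda>l k. trunc B (l k (x k))) ` L0"
  have lip: "\<bar>2 * (\<theta> * a) - 2 * (\<theta> * b)\<bar> \<le> 8 * \<theta> * B * d" if "\<bar>a - b\<bar> \<le> 4 * B * d" for a b d
  proof -
    have "\<bar>2 * (\<theta> * a) - 2 * (\<theta> * b)\<bar> = 2 * \<theta> * \<bar>a - b\<bar>"
      using \<theta> by (simp add: abs_mult flip: right_diff_distrib)
    also have "\<dots> \<le> 2 * \<theta> * (4 * B * d)" using that \<theta> by (intro mult_left_mono) auto
    finally show ?thesis by simp
  qed
  have "?lhs = (\<Sum>I\<in>Pow {1..n}. sup_exp T (\<lambda>g. \<Sum>k\<in>{1..n}.
      if k \<in> I then ?P k (g (x k)) else ?Q k (g (x k))))"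
    by (simp add: if_distrib cong: if_cong)
  also have "\<dots> \<le> ennreal (2 ^ card {1..n} * exp (8 * \<theta> * B * (real n * r)) * real (card L1))"
  proof (rule sum_sup_exp_le_cover[where V = "{-B..B}"])
    fix g assume "g \<in> T"
    then have g: "g \<in> G" using T by auto
    then have "(\<lambda>x. trunc B (g x)) \<in> trunc_family B G" by (auto simp: trunc_family_def)
    from cov[OF this] obtain l where l: "l \<in> L0"
      "(1 / real n) * (\<Sum>k=1..n. \<bar>l k (x k) - trunc B (g (x k))\<bar>) \<le> r" by blast
    have "(\<Sum>k\<in>{1..n}. \<bar>g (x k) - trunc B (l k (x k))\<bar>) \<le> (\<Sum>k\<in>{1..n}. \<bar>l k (x k) - g (x k)\<bar>)"
      by (intro sum_mono abs_trunc_diff_le G g)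
    also have "\<dots> \<le> real n * r"
      using l(2) n G[OF g] by (simp add: trunc_eq field_simps)
    finally show "\<exists>l\<in>L1. (\<Sum>k\<in>{1..n}. \<bar>g (x k) - l k\<bar>) \<le> real n * r"
      using l(1) unfolding L1_def by auto
  next
    fix k a b assume "a \<in> {-B..B}" "b \<in> {-B..B}"
    then have ab: "\<bar>a\<bar> \<le> B" "\<bar>b\<bar> \<le> B" by auto
    show "\<bar>?P k a - ?P k b\<bar> \<le> 8 * \<theta> * B * \<bar>a - b\<bar>"
      by (intro lip excess_lipschitz z w ab) (use s in auto)
    have "\<bar>?Q k a - ?Q k b\<bar> = \<bar>2 * (\<theta> * excess (z k) (w (x k)) a) - 2 * (\<theta> * excess (z k) (w (x k)) b)\<bar>"
      by simp
    also have "\<dots> \<le> 8 * \<theta> * B * \<bar>a - b\<bar>"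
      by (intro lip) (use excess_lipschitz[OF z w ab, where s = 0] in auto)
    finally show "\<bar>?Q k a - ?Q k b\<bar> \<le> 8 * \<theta> * B * \<bar>a - b\<bar>" .
  next
    fix k a assume "a \<in> {-B..B}"
    then show "exp (?P k a) + exp (?Q k a) \<le> 2"
      by (intro excess_exp_balance[of _ B] z w) (use s \<theta> in auto)
  next
    fix g k assume "g \<in> T" then show "g (x k) \<in> {-B..B}"
      using G[of g "x k"] T by auto
  next
    fix l k assume "l \<in> L1" then show "l k \<in> {-B..B}"
      using abs_trunc_le[OF B] by (auto simp: L1_def abs_le_iff minus_le_iff)
  qed (use fin \<theta> B in \<open>auto simp: L1_def\<close>)
  also have "\<dots> \<le> ennreal (2 ^ n * exp (8 * \<theta> * B * real n * r) * real (card L0))"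
    using fin by (intro ennreal_leI) (auto simp: L1_def card_image_le mult.assoc)
  finally show "?lhs \<le> ennreal (2 ^ n * exp (8 * \<theta> * B * real n * r) * real (card L0))" .
qed simp

section \<open>A uniform deviation inequality for the excess loss\<close>

lemma abs_excess_le:
  assumes "\<bar>z\<bar> \<le> B" "\<bar>w\<bar> \<le> B" "\<bar>v\<bar> \<le> B"
  shows "\<bar>excess z w v\<bar> \<le> 4 * B\<^sup>2"
proof -
  have "(a - z)\<^sup>2 \<le> (2 * B)\<^sup>2" if "\<bar>a\<bar> \<le> B" for a
    using assms that by (intro abs_le_square_iff[THEN iffD1]) auto
  then have "(v - z)\<^sup>2 \<le> (2 * B)\<^sup>2" "(w - z)\<^sup>2 \<le> (2 * B)\<^sup>2" using assms by auto
  moreover have "0 \<le> (v - z)\<^sup>2" "0 \<le> (w - z)\<^sup>2" by auto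
  moreover have "(2 * B)\<^sup>2 = 4 * B\<^sup>2" by (simp add: power_mult_distrib)
  ultimately show ?thesis unfolding excess_def by linarith
qed

lemma square_diff_le:
  fixes v w :: real
  assumes "\<bar>w\<bar> \<le> B" "\<bar>v\<bar> \<le> B"
  shows "(v - w)\<^sup>2 \<le> 4 * B\<^sup>2"
proof -
  have "(v - w)\<^sup>2 \<le> (2 * B)\<^sup>2"
    using assms by (intro abs_le_square_iff[THEN iffD1]) auto
  then show ?thesis by (simp add: power_mult_distrib)
qed

lemma abs_offset_excess_le:
  assumes "\<bar>z\<bar> \<le> B" "\<bar>w\<bar> \<le> B" "\<bar>v\<bar> \<le> B" "0 \<le> s" "s \<le> 1 / 2"
  shows "\<bar>excess z w v - 2 * s * (v - w)\<^sup>2\<bar> \<le> 8 * B\<^sup>2"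
proof -
  have "(2 * s) * (v - w)\<^sup>2 \<le> 1 * (4 * B\<^sup>2)"
    using assms square_diff_le[OF assms(2,3)] by (intro mult_mono) auto
  moreover have "0 \<le> (2 * s) * (v - w)\<^sup>2" using assms by simp
  ultimately show ?thesis
    using abs_excess_le[OF assms(1-3)] by linarith
qed

text \<open>Markov's inequality for the exponential of the supremum of
  \<open>S g = \<theta> * (\<Sum>k. E h\<^sub>g - 2 * s * E q\<^sub>g - h\<^sub>g (D\<^sub>k))\<close>, where \<open>D\<^sub>k\<close> are the observations, \<open>h\<^sub>g\<close> is
  the excess loss over \<open>gt\<close> and \<open>q\<^sub>g\<close> the squared distance to \<open>gt\<close>. Symmetrization with
  \<open>p = \<theta> * (h - 2 * s * q)\<close> and \<open>m = - \<theta> * h\<close> bounds its expectation by an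
  average over signs. There the offset cancels the Laplace transform of the signs, and only the
  covering number of the given sample and the covering error \<open>8 * \<theta> * B * n * r\<close> remain. The supremum runs
  over a countable dense family; outside the exceptional event the bound passes to all of \<open>G\<close>,
  since the inequality is preserved under bounded pointwise limits.\<close>
lemma uniform_excess_deviation:
  fixes M :: "'w measure" and X :: "nat \<Rightarrow> 'w \<Rightarrow> 'a::polish_space" and Y :: "nat \<Rightarrow> 'w \<Rightarrow> real"
    and G :: "('a \<Rightarrow> real) set" and gt :: "'a \<Rightarrow> real"
  assumes M: "prob_space M" and n: "n \<ge> 1" and B: "B > 0"
    and indep: "prob_space.indep_vars M (\<lambda>_. borel :: ('a \<times> real) measure)
           (\<lambda>k \<omega>. (X k \<omega>, Y k \<omega>)) {1..n}"
    and G: "pointwise_measurable G" "\<And>g. g \<in> G \<Longrightarrow> g \<in> borel_measurable borel"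
      "\<And>g x. g \<in> G \<Longrightarrow> \<bar>g x\<bar> \<le> B"
    and gt: "gt \<in> G"
    and s: "0 < s" "s \<le> 1 / 2" "16 * B\<^sup>2 * \<theta> = s" and r: "r > 0"
  shows "\<exists>E\<in>sets M. emeasure M (space M - E)
        \<le> ennreal (exp (- (\<theta> * real n * (u - 8 * B * r))))
          * (\<integral>\<^sup>+\<omega>. ennreal_of_enat (covering_number n (trunc_family B G) (\<lambda>k. X k \<omega>) r) \<partial>M) \<and>
      (\<forall>\<omega>\<in>E. \<forall>g\<in>G.
        (\<Sum>k=1..n. (\<integral>\<omega>'. excess (trunc B (Y k \<omega>')) (gt (X k \<omega>')) (g (X k \<omega>'))
              - 2 * s * (g (X k \<omega>') - gt (X k \<omega>'))\<^sup>2 \<partial>M)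
          - excess (trunc B (Y k \<omega>)) (gt (X k \<omega>)) (g (X k \<omega>))) \<le> real n * u)"
proof -
  interpret prob_space M by (rule M)
  have \<theta>: "\<theta> > 0" using s B by (auto simp: zero_less_mult_iff dest!: sym[of _ s])
  let ?J = "{1..n}"
  let ?D = "\<lambda>k \<omega>. (X k \<omega>, Y k \<omega>)"
  have D [measurable]: "?D k \<in> measurable M borel" if "k \<in> ?J" for k
    using indep that unfolding indep_vars_def by blast
  \<comment> \<open>Indices outside \<open>1..n\<close> get an arbitrary point mass: the product is taken from a family of probability measures over all indices.\<close>
  define \<mu> where "\<mu> k = (if k \<in> ?J then distr M borel (?D k) else return borel undefined)" for k
  have \<mu>: "prob_space (\<mu> k)" for k
    unfolding \<mu>_def by (auto intro: prob_space_distr D prob_space_return)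
  have sets_\<mu> [measurable_cong]: "sets (\<mu> k) = sets borel" for k
    unfolding \<mu>_def by simp
  define h :: "('a \<Rightarrow> real) \<Rightarrow> 'a \<times> real \<Rightarrow> real"
    where "h g d = excess (trunc B (snd d)) (gt (fst d)) (g (fst d))" for g d
  define p where "p g d = \<theta> * (h g d - 2 * s * (g (fst d) - gt (fst d))\<^sup>2)" for g d
  define m where "m g d = - \<theta> * h g d" for g d
  have fst_meas [measurable]: "(fst :: 'a \<times> real \<Rightarrow> 'a) \<in> borel \<rightarrow>\<^sub>M borel"
    by (intro borel_measurable_continuous_onI continuous_on_fst continuous_on_id)
  have snd_meas [measurable]: "(snd :: 'a \<times> real \<Rightarrow> real) \<in> borel \<rightarrow>\<^sub>M borel"
    by (intro borel_measurable_continuous_onI continuous_on_snd continuous_on_id)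
  have h_meas: "h g \<in> borel_measurable borel" if "g \<in> G" for g
  proof -
    note [measurable] = G(2)[OF that] G(2)[OF gt]
    show ?thesis unfolding h_def excess_def trunc_def by measurable
  qed
  have p_meas: "p g \<in> borel_measurable borel" if "g \<in> G" for g
  proof -
    note [measurable] = G(2)[OF that] G(2)[OF gt] h_meas[OF that]
    show ?thesis unfolding p_def by measurable
  qed
  have m_meas: "m g \<in> borel_measurable (\<mu> k)" if "g \<in> G" for g k
  proof -
    note [measurable] = h_meas[OF that]
    show ?thesis unfolding m_def by measurable
  qed
  have p_bound: "\<bar>p g d\<bar> \<le> \<theta> * (8 * B\<^sup>2)" if "g \<in> G" for g d
    unfolding p_def h_def abs_mult using \<theta> s
    by (intro mult_mono abs_offset_excess_le abs_trunc_le[OF B] G that gt) auto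
  have p_int: "integrable (\<mu> k) (p g)" if "g \<in> G" for g k
  proof -
    interpret \<mu>: prob_space "\<mu> k" by (rule \<mu>)
    have [measurable]: "p g \<in> borel_measurable (\<mu> k)"
      using p_meas[OF that] by measurable
    show ?thesis
      by (rule \<mu>.integrable_const_bound[where B = "\<theta> * (8 * B\<^sup>2)"]) (auto simp: p_bound[OF that])
  qed

  obtain G0 where G0: "G0 \<subseteq> G" "countable G0"
    and dense: "\<And>g. g \<in> G \<Longrightarrow> \<exists>t. (\<forall>i::nat. t i \<in> G0) \<and> (\<forall>x. (\<lambda>i. t i x) \<longlonglongrightarrow> g x)"
    using G(1) unfolding pointwise_measurable_def by metis

  define S where "S g x = (\<Sum>k\<in>?J. (\<integral>y. p g y \<partial>\<mu> k) + m g (x k))" for g x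
  define R where "R x = (\<Sum>I\<in>Pow ?J. sup_exp G0 (\<lambda>g. \<Sum>k\<in>?J. 2 * (if k \<in> I then p g (x k) else m g (x k))))" for x
  define Z where "Z \<omega> = (\<lambda>k\<in>?J. ?D k \<omega>)" for \<omega>
  have Z_meas [measurable]: "Z \<in> M \<rightarrow>\<^sub>M PiM ?J \<mu>"
    unfolding Z_def by (rule measurable_restrict) (use D in measurable)
  have law: "distr M (PiM ?J \<mu>) Z = PiM ?J \<mu>"
  proof -
    have "distr M (\<Pi>\<^sub>M k\<in>?J. borel) (\<lambda>\<omega>. \<lambda>k\<in>?J. ?D k \<omega>) = (\<Pi>\<^sub>M k\<in>?J. distr M borel (?D k))"
      using indep_vars_iff_distr_eq_PiM'[of ?J ?D "\<lambda>_. borel"] indep D n by auto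
    moreover have "(\<Pi>\<^sub>M k\<in>?J. distr M borel (?D k)) = PiM ?J \<mu>"
      by (rule PiM_cong) (auto simp: \<mu>_def)
    moreover have "distr M (\<Pi>\<^sub>M k\<in>?J. borel) (\<lambda>\<omega>. \<lambda>k\<in>?J. ?D k \<omega>) = distr M (PiM ?J \<mu>) Z"
      unfolding Z_def[abs_def] by (rule distr_cong) (auto simp: sets_\<mu> intro!: sets_PiM_cong)
    ultimately show ?thesis by simp
  qed
  have transfer: "(\<integral>\<^sup>+x. f x \<partial>PiM ?J \<mu>) = (\<integral>\<^sup>+\<omega>. f (Z \<omega>) \<partial>M)"
    if f: "f \<in> borel_measurable (PiM ?J \<mu>)" for f :: "(nat \<Rightarrow> 'a \<times> real) \<Rightarrow> ennreal"
  proof -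
    have "f \<in> borel_measurable (distr M (PiM ?J \<mu>) Z)" using f by simp
    from nn_integral_distr[OF Z_meas this] show ?thesis unfolding law .
  qed
  have p_meas\<mu>: "p g \<in> borel_measurable (\<mu> k)" if "g \<in> G0" for g k
    using p_int G0(1) that by auto
  have m_meas\<mu>: "m g \<in> borel_measurable (\<mu> k)" if "g \<in> G0" for g k
    using m_meas G0(1) that by auto
  note [measurable] = p_meas\<mu> m_meas\<mu> G0(2)
  have S_meas [measurable]: "(\<lambda>x. sup_exp G0 (\<lambda>g. S g x)) \<in> borel_measurable (PiM ?J \<mu>)"
    unfolding S_def by measurable
  have R_meas [measurable]: "R \<in> borel_measurable (PiM ?J \<mu>)"
    unfolding R_def by measurable
  let ?N = "\<lambda>\<omega>. ennreal_of_enat (covering_number n (trunc_family B G) (\<lambda>k. X k \<omega>) r)"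
  have R_le: "R (Z \<omega>) \<le> ennreal (2 ^ n * exp (8 * \<theta> * B * real n * r)) * ?N \<omega>" for \<omega>
  proof -
    have "R (Z \<omega>) = (\<Sum>I\<in>Pow {1..n}. sup_exp G0 (\<lambda>g. \<Sum>k\<in>{1..n}. 2 * (if k \<in> I
        then \<theta> * (excess (trunc B (Y k \<omega>)) (gt (X k \<omega>)) (g (X k \<omega>)) - 2 * s * (g (X k \<omega>) - gt (X k \<omega>))\<^sup>2)
        else - \<theta> * excess (trunc B (Y k \<omega>)) (gt (X k \<omega>)) (g (X k \<omega>)))))"
      unfolding R_def p_def m_def h_def
      by (intro sum.cong refl arg_cong[where f = "sup_exp G0"] ext) (simp add: Z_def)
    also have "\<dots> \<le> ennreal (2 ^ n * exp (8 * \<theta> * B * real n * r)) * ?N \<omega>"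
      by (rule sup_exp_signs_le_covering_number[where x = "\<lambda>k. X k \<omega>" and z = "\<lambda>k. trunc B (Y k \<omega>)"
            and w = gt and s = s and G = G and T = G0])
        (use n B s r G(3) G(3)[OF gt] G0(1) abs_trunc_le[OF B] in auto)
    finally show ?thesis .
  qed
  have card_J: "card ?J = n" by simp
  have "2 ^ n * (\<integral>\<^sup>+\<omega>. sup_exp G0 (\<lambda>g. S g (Z \<omega>)) \<partial>M)
      = 2 ^ card ?J * (\<integral>\<^sup>+x. sup_exp G0 (\<lambda>g. 0 + S g x) \<partial>PiM ?J \<mu>)"
    by (simp only: transfer[OF S_meas] add_0 card_J)
  also have "\<dots> \<le> (\<integral>\<^sup>+x. R x \<partial>PiM ?J \<mu>)"
    unfolding S_def R_def
    using offset_symmetrization[of \<mu> ?J G0 p m "\<lambda>_. 0"] \<mu> G0(1) p_int m_meas by (simp add: G0(2) subset_iff)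
  also have "\<dots> = (\<integral>\<^sup>+\<omega>. R (Z \<omega>) \<partial>M)"
    by (rule transfer[OF R_meas])
  also have "\<dots> \<le> ennreal (2 ^ n * exp (8 * \<theta> * B * real n * r)) * (\<integral>\<^sup>+\<omega>. ?N \<omega> \<partial>M)"
    by (rule nn_integral_le_cmult) (use R_le in auto)
  also have "\<dots> = 2 ^ n * (ennreal (exp (8 * \<theta> * B * real n * r)) * (\<integral>\<^sup>+\<omega>. ?N \<omega> \<partial>M))"
    by (simp add: ennreal_mult ennreal_power[symmetric] mult.assoc)
  finally have main: "(\<integral>\<^sup>+\<omega>. sup_exp G0 (\<lambda>g. S g (Z \<omega>)) \<partial>M)
      \<le> ennreal (exp (8 * \<theta> * B * real n * r)) * (\<integral>\<^sup>+\<omega>. ?N \<omega> \<partial>M)"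
    by (subst (asm) ennreal_mult_le_mult_iff) (auto simp: power_eq_top_ennreal)

  let ?c = "ennreal (exp (- (\<theta> * real n * u)))"
  define Bad where "Bad = {\<omega>\<in>space M. 1 \<le> ?c * sup_exp G0 (\<lambda>g. S g (Z \<omega>))}"
  have sup_meas [measurable]: "(\<lambda>\<omega>. sup_exp G0 (\<lambda>g. S g (Z \<omega>))) \<in> borel_measurable M"
    by measurable
  have Bad: "Bad \<in> sets M" unfolding Bad_def by measurable
  have "emeasure M Bad \<le> ?c * (\<integral>\<^sup>+\<omega>. sup_exp G0 (\<lambda>g. S g (Z \<omega>)) * indicator (space M) \<omega> \<partial>M)"
    unfolding Bad_def by (rule nn_integral_Markov_inequality) auto
  also have "\<dots> = ?c * (\<integral>\<^sup>+\<omega>. sup_exp G0 (\<lambda>g. S g (Z \<omega>)) \<partial>M)"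
    by (intro arg_cong2[where f = "(*)"] refl nn_integral_cong) auto
  also have "\<dots> \<le> ?c * (ennreal (exp (8 * \<theta> * B * real n * r)) * (\<integral>\<^sup>+\<omega>. ?N \<omega> \<partial>M))"
    by (intro mult_left_mono main) auto
  also have "\<dots> = ennreal (exp (- (\<theta> * real n * (u - 8 * B * r)))) * (\<integral>\<^sup>+\<omega>. ?N \<omega> \<partial>M)"
  proof -
    have "exp (- (\<theta> * real n * u)) * exp (8 * \<theta> * B * real n * r)
        = exp (- (\<theta> * real n * (u - 8 * B * r)))"
      by (subst exp_add[symmetric]) (simp add: algebra_simps)
    then have "?c * ennreal (exp (8 * \<theta> * B * real n * r))
        = ennreal (exp (- (\<theta> * real n * (u - 8 * B * r))))"
      by (subst ennreal_mult'[symmetric]) simp_all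
    then show ?thesis by (simp only: mult.assoc[symmetric])
  qed
  finally have prob_Bad: "emeasure M Bad \<le> ennreal (exp (- (\<theta> * real n * (u - 8 * B * r)))) * (\<integral>\<^sup>+\<omega>. ?N \<omega> \<partial>M)" .

  have good0: "S g (Z \<omega>) \<le> \<theta> * real n * u" if \<omega>: "\<omega> \<in> space M - Bad" and g: "g \<in> G0" for \<omega> g
  proof (rule ccontr)
    assume "\<not> ?thesis"
    then have "1 \<le> exp (- (\<theta> * real n * u)) * exp (S g (Z \<omega>))"
      by (simp flip: exp_add)
    then have "1 \<le> ?c * ennreal (exp (S g (Z \<omega>)))"
      by (simp flip: ennreal_mult)
    also have "\<dots> \<le> ?c * sup_exp G0 (\<lambda>g. S g (Z \<omega>))"
      by (intro mult_left_mono sup_exp_upper[OF g, where a = "\<lambda>g. S g (Z \<omega>)"]) auto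
    finally show False using \<omega> by (auto simp: Bad_def)
  qed
  have good: "S g (Z \<omega>) \<le> \<theta> * real n * u" if \<omega>: "\<omega> \<in> space M - Bad" and g: "g \<in> G" for \<omega> g
  proof -
    from dense[OF g] obtain t where t: "\<And>i. t i \<in> G0" "\<And>x. (\<lambda>i. t i x) \<longlonglongrightarrow> g x" by blast
    have tG: "t i \<in> G" for i using t(1) G0(1) by auto
    have h_lim: "(\<lambda>i. h (t i) d) \<longlonglongrightarrow> h g d" for d
      unfolding h_def excess_def by (intro tendsto_intros t)
    have p_lim: "(\<lambda>i. p (t i) d) \<longlonglongrightarrow> p g d" for d
      unfolding p_def by (intro tendsto_intros t h_lim)
    have m_lim: "(\<lambda>i. m (t i) d) \<longlonglongrightarrow> m g d" for d
      unfolding m_def by (intro tendsto_intros h_lim)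
    have int_lim: "(\<lambda>i. \<integral>d. p (t i) d \<partial>\<mu> k) \<longlonglongrightarrow> (\<integral>d. p g d \<partial>\<mu> k)" for k
    proof (rule integral_dominated_convergence[where w = "\<lambda>_. \<theta> * (8 * B\<^sup>2)"])
      interpret \<mu>: prob_space "\<mu> k" by (rule \<mu>)
      show "integrable (\<mu> k) (\<lambda>_. \<theta> * (8 * B\<^sup>2))" by simp
    qed (use p_int[OF g] p_int[OF tG] p_lim p_bound[OF tG] in auto)
    have "(\<lambda>i. S (t i) (Z \<omega>)) \<longlonglongrightarrow> S g (Z \<omega>)"
      unfolding S_def by (intro tendsto_intros int_lim m_lim)
    then show ?thesis
      by (rule LIMSEQ_le_const2) (use good0[OF \<omega> t(1)] in auto)
  qed
  have S_eq: "S g (Z \<omega>) = \<theta> * (\<Sum>k=1..n. (\<integral>\<omega>'. excess (trunc B (Y k \<omega>')) (gt (X k \<omega>')) (g (X k \<omega>'))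
              - 2 * s * (g (X k \<omega>') - gt (X k \<omega>'))\<^sup>2 \<partial>M)
          - excess (trunc B (Y k \<omega>)) (gt (X k \<omega>)) (g (X k \<omega>)))" if g: "g \<in> G" for g \<omega>
    unfolding S_def sum_distrib_left
  proof (rule sum.cong)
    fix k assume k: "k \<in> ?J"
    have "(\<integral>y. p g y \<partial>\<mu> k) = (\<integral>\<omega>'. p g (?D k \<omega>') \<partial>M)"
      using k p_meas[OF g] by (simp add: \<mu>_def integral_distr[OF D[OF k]])
    also have "\<dots> = \<theta> * (\<integral>\<omega>'. excess (trunc B (Y k \<omega>')) (gt (X k \<omega>')) (g (X k \<omega>'))
              - 2 * s * (g (X k \<omega>') - gt (X k \<omega>'))\<^sup>2 \<partial>M)"
      unfolding p_def h_def fst_conv snd_conv by (rule integral_mult_right_zero)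
    finally show "(\<integral>y. p g y \<partial>\<mu> k) + m g (Z \<omega> k) = \<theta> * ((\<integral>\<omega>'. excess (trunc B (Y k \<omega>')) (gt (X k \<omega>')) (g (X k \<omega>'))
              - 2 * s * (g (X k \<omega>') - gt (X k \<omega>'))\<^sup>2 \<partial>M)
          - excess (trunc B (Y k \<omega>)) (gt (X k \<omega>)) (g (X k \<omega>)))"
      using k by (simp add: h_def m_def Z_def right_diff_distrib)
  qed simp
  show ?thesis
  proof (intro bexI conjI ballI)
    show "space M - Bad \<in> sets M" using Bad by auto
    have "space M - (space M - Bad) = Bad" unfolding Bad_def by auto
    then show "emeasure M (space M - (space M - Bad))
        \<le> ennreal (exp (- (\<theta> * real n * (u - 8 * B * r)))) * (\<integral>\<^sup>+\<omega>. ?N \<omega> \<partial>M)"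
      using prob_Bad by simp
    fix \<omega> g assume "\<omega> \<in> space M - Bad" "g \<in> G"
    from good[OF this] have "\<theta> * (\<Sum>k=1..n. (\<integral>\<omega>'. excess (trunc B (Y k \<omega>')) (gt (X k \<omega>')) (g (X k \<omega>'))
              - 2 * s * (g (X k \<omega>') - gt (X k \<omega>'))\<^sup>2 \<partial>M)
          - excess (trunc B (Y k \<omega>)) (gt (X k \<omega>)) (g (X k \<omega>))) \<le> \<theta> * (real n * u)"
      unfolding S_eq[OF \<open>g \<in> G\<close>] by (simp add: mult.assoc)
    then show "(\<Sum>k=1..n. (\<integral>\<omega>'. excess (trunc B (Y k \<omega>')) (gt (X k \<omega>')) (g (X k \<omega>'))
              - 2 * s * (g (X k \<omega>') - gt (X k \<omega>'))\<^sup>2 \<partial>M)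
          - excess (trunc B (Y k \<omega>)) (gt (X k \<omega>)) (g (X k \<omega>))) \<le> real n * u"
      using \<theta> by simp
  qed
qed

section \<open>Conditional expectation as regression target\<close>

lemma (in prob_space) real_cond_exp_square_le:
  assumes F: "subalgebra M F" and f [measurable]: "f \<in> borel_measurable M"
    and f2: "integrable M (\<lambda>x. (f x)\<^sup>2)"
  shows "integrable M (\<lambda>x. (real_cond_exp M F f x)\<^sup>2)"
    and "expectation (\<lambda>x. (real_cond_exp M F f x)\<^sup>2) \<le> expectation (\<lambda>x. (f x)\<^sup>2)"
proof -
  interpret finite_measure_subalgebra M F by unfold_locales (rule F)
  have f1: "integrable M f" by (rule square_integrable_imp_integrable[OF f f2])
  have "convex_on UNIV (\<lambda>x::real. x\<^sup>2)" by (rule convex_power2)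
  then have le: "AE x in M. (real_cond_exp M F f x)\<^sup>2 \<le> real_cond_exp M F (\<lambda>x. (f x)\<^sup>2) x"
    using real_cond_exp_jensens_inequality(2)[OF f1, of UNIV _ _ "\<lambda>x. x\<^sup>2"] f2 by auto
  show int: "integrable M (\<lambda>x. (real_cond_exp M F f x)\<^sup>2)"
    by (rule Bochner_Integration.integrable_bound[OF real_cond_exp_int(1)[OF f2]]) (use le in auto)
  have "expectation (\<lambda>x. (real_cond_exp M F f x)\<^sup>2) \<le> expectation (real_cond_exp M F (\<lambda>x. (f x)\<^sup>2))"
    by (rule integral_mono_AE[OF int real_cond_exp_int(1)[OF f2] le])
  then show "expectation (\<lambda>x. (real_cond_exp M F f x)\<^sup>2) \<le> expectation (\<lambda>x. (f x)\<^sup>2)"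
    unfolding real_cond_exp_int(2)[OF f2] .
qed

lemma (in prob_space) integrable_square_diff:
  fixes f g :: "'a \<Rightarrow> real"
  assumes [measurable]: "f \<in> borel_measurable M" "g \<in> borel_measurable M"
    and f: "integrable M (\<lambda>x. (f x)\<^sup>2)" and g: "integrable M (\<lambda>x. (g x)\<^sup>2)"
  shows "integrable M (\<lambda>x. (f x - g x)\<^sup>2)"
proof (rule Bochner_Integration.integrable_bound)
  show "integrable M (\<lambda>x. 2 * (f x)\<^sup>2 + 2 * (g x)\<^sup>2)" using f g by simp
  have "(f x - g x)\<^sup>2 \<le> 2 * (f x)\<^sup>2 + 2 * (g x)\<^sup>2" for x
  proof -
    have "0 \<le> (f x + g x)\<^sup>2" by simp
    then show ?thesis by (simp add: power2_eq_square algebra_simps)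
  qed
  then show "AE x in M. norm ((f x - g x)\<^sup>2) \<le> norm (2 * (f x)\<^sup>2 + 2 * (g x)\<^sup>2)" by simp
qed simp

lemma (in prob_space) integrable_square_bounded:
  fixes f :: "'a \<Rightarrow> real"
  assumes [measurable]: "f \<in> borel_measurable M" and "\<And>x. \<bar>f x\<bar> \<le> C"
  shows "integrable M (\<lambda>x. (f x)\<^sup>2)"
proof (rule integrable_const_bound)
  have "(f x)\<^sup>2 \<le> C\<^sup>2" for x
    by (rule abs_le_square_iff[THEN iffD1]) (use assms(2)[of x] in auto)
  then show "AE x in M. norm ((f x)\<^sup>2) \<le> C\<^sup>2" by simp
qed simp

text \<open>Seen through \<open>F\<close>-measurable predictions, the response \<open>Z\<close> may be replaced by its conditional
  expectation \<open>W\<close>: in \<open>(v - Z)\<^sup>2 - (w - Z)\<^sup>2\<close> the term \<open>Z\<^sup>2\<close> cancels, and \<open>Z\<close> only appears in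
  the product with the \<open>F\<close>-measurable \<open>v - w\<close>.\<close>
lemma (in prob_space) expectation_excess:
  assumes F: "subalgebra M F"
    and Z: "Z \<in> borel_measurable M" "integrable M (\<lambda>x. (Z x)\<^sup>2)"
    and v: "v \<in> borel_measurable F" "\<And>x. \<bar>v x\<bar> \<le> C"
    and w: "w \<in> borel_measurable F" "\<And>x. \<bar>w x\<bar> \<le> C"
  shows "expectation (\<lambda>x. excess (Z x) (w x) (v x))
    = expectation (\<lambda>x. (v x - real_cond_exp M F Z x)\<^sup>2) - expectation (\<lambda>x. (w x - real_cond_exp M F Z x)\<^sup>2)"
proof -
  interpret finite_measure_subalgebra M F by unfold_locales (rule F)
  let ?W = "real_cond_exp M F Z"
  note [measurable] = Z(1) measurable_from_subalg[OF F v(1)] measurable_from_subalg[OF F w(1)]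
  have Z1: "integrable M Z" by (rule square_integrable_imp_integrable[OF Z])
  have W2: "integrable M (\<lambda>x. (?W x)\<^sup>2)" by (rule real_cond_exp_square_le[OF F Z])
  have vZ: "integrable M (\<lambda>x. (v x - w x) * Z x)"
  proof (rule Bochner_Integration.integrable_bound)
    show "integrable M (\<lambda>x. (2 * C) * Z x)" using Z1 by simp
    have "\<bar>v x - w x\<bar> \<le> \<bar>2 * C\<bar>" for x using v(2)[of x] w(2)[of x] by linarith
    then show "AE x in M. norm ((v x - w x) * Z x) \<le> norm ((2 * C) * Z x)"
      unfolding real_norm_def abs_mult[of _ "Z _"] by (intro AE_I2 mult_right_mono) auto
  qed simp
  have vwF: "(\<lambda>x. v x - w x) \<in> borel_measurable F" using v(1) w(1) by simp
  note W = real_cond_exp_intg[OF vZ vwF Z(1)]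
  have vw: "integrable M (\<lambda>x. (v x)\<^sup>2 - (w x)\<^sup>2)"
    by (intro Bochner_Integration.integrable_diff integrable_square_bounded[where C = C]) (auto simp: v w)
  have "expectation (\<lambda>x. excess (Z x) (w x) (v x))
      = expectation (\<lambda>x. ((v x)\<^sup>2 - (w x)\<^sup>2) - 2 * ((v x - w x) * Z x))"
    by (intro Bochner_Integration.integral_cong) (auto simp: excess_def power2_eq_square algebra_simps)
  also have "\<dots> = expectation (\<lambda>x. ((v x)\<^sup>2 - (w x)\<^sup>2) - 2 * ((v x - w x) * ?W x))"
    using vw vZ W by simp
  also have "\<dots> = expectation (\<lambda>x. (v x - ?W x)\<^sup>2 - (w x - ?W x)\<^sup>2)"
    by (intro Bochner_Integration.integral_cong) (auto simp: power2_eq_square algebra_simps)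
  also have "\<dots> = expectation (\<lambda>x. (v x - ?W x)\<^sup>2) - expectation (\<lambda>x. (w x - ?W x)\<^sup>2)"
    by (intro Bochner_Integration.integral_diff integrable_square_diff integrable_square_bounded[where C = C] W2)
      (auto simp: v w)
  finally show ?thesis .
qed

lemma square_add_le:
  fixes x y a :: real
  assumes "a > 0"
  shows "(x + y)\<^sup>2 \<le> (1 + a) * x\<^sup>2 + (1 + 1 / a) * y\<^sup>2"
proof -
  have "0 \<le> (a * x - y)\<^sup>2 / a" using assms by simp
  also have "(a * x - y)\<^sup>2 / a = (1 + a) * x\<^sup>2 + (1 + 1 / a) * y\<^sup>2 - (x + y)\<^sup>2"
    using assms by (simp add: power2_eq_square field_simps)
  finally show ?thesis by simp
qed

lemma subalgebra_vimage_algebra: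
  assumes "f \<in> M \<rightarrow>\<^sub>M N"
  shows "subalgebra M (vimage_algebra (space M) f N)"
  unfolding subalgebra_def using assms by (auto simp: sets_image_in_sets[OF refl assms, THEN subsetD])

lemma square_trunc_residual:
  assumes "B > 0"
  shows "(trunc B y - y)\<^sup>2 = (\<bar>y\<bar> - B)\<^sup>2 * indicator {x. \<bar>x\<bar> > B} y"
proof (cases "\<bar>y\<bar> > B")
  case True
  then have "\<bar>trunc B y - y\<bar> = \<bar>y\<bar> - B" using assms by (auto simp: trunc_def)
  then have "\<bar>trunc B y - y\<bar>\<^sup>2 = (\<bar>y\<bar> - B)\<^sup>2" by (rule arg_cong)
  then show ?thesis using True by simp
next
  case False
  then show ?thesis by (simp add: trunc_eq)
qed

text \<open>The targets \<open>W = E[trunc B Y | X]\<close> and \<open>\<phi> (X) = E[Y | X]\<close> differ by the conditional expectation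
  of \<open>trunc B Y - Y\<close>. By Jensen's inequality its second moment is at most that of
  \<open>trunc B Y - Y\<close>, which is \<open>R\<close>. So changing the target costs a weighted square with
  \<open>R\<close>, in either direction.\<close>
lemma (in prob_space) truncated_regression_distance:
  fixes Xk :: "'a \<Rightarrow> 'b::topological_space" and Yk :: "'a \<Rightarrow> real"
  assumes B: "B > 0" and X [measurable]: "Xk \<in> borel_measurable M"
    and Y [measurable]: "Yk \<in> borel_measurable M" and Y2: "integrable M (\<lambda>\<omega>. (Yk \<omega>)\<^sup>2)"
    and \<Phi> [measurable]: "\<phi> \<in> borel_measurable borel"
    and ae: "AE \<omega> in M. \<phi> (Xk \<omega>) = real_cond_exp M (vimage_algebra (space M) Xk borel) Yk \<omega>"
    and g [measurable]: "g \<in> borel_measurable borel" and gB: "\<And>x. \<bar>g x\<bar> \<le> B" and a: "a > 0"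
  defines "W \<equiv> real_cond_exp M (vimage_algebra (space M) Xk borel) (\<lambda>\<omega>. trunc B (Yk \<omega>))"
    and "R \<equiv> (\<integral>\<omega>. (\<bar>Yk \<omega>\<bar> - B)\<^sup>2 * indicator {\<omega>'. \<bar>Yk \<omega>'\<bar> > B} \<omega> \<partial>M)"
  shows "(L2_norm (distr M borel Xk) (\<lambda>x. g x - \<phi> x))\<^sup>2
      \<le> \<xi> a * expectation (\<lambda>\<omega>. (g (Xk \<omega>) - W \<omega>)\<^sup>2) + \<xi> (1 / a) * R"
    and "expectation (\<lambda>\<omega>. (g (Xk \<omega>) - W \<omega>)\<^sup>2)
      \<le> \<xi> a * (L2_norm (distr M borel Xk) (\<lambda>x. g x - \<phi> x))\<^sup>2 + \<xi> (1 / a) * R"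
proof -
  let ?F = "vimage_algebra (space M) Xk borel"
  have F: "subalgebra M ?F" by (rule subalgebra_vimage_algebra) (rule X)
  interpret finite_measure_subalgebra M ?F by unfold_locales (rule F)
  have T [measurable]: "(\<lambda>\<omega>. trunc B (Yk \<omega>)) \<in> borel_measurable M"
    unfolding trunc_def by measurable
  have T2: "integrable M (\<lambda>\<omega>. (trunc B (Yk \<omega>))\<^sup>2)"
    by (rule integrable_square_bounded[where C = B]) (auto simp: abs_trunc_le[OF B])
  let ?e = "\<lambda>\<omega>. trunc B (Yk \<omega>) - Yk \<omega>"
  define C where "C = real_cond_exp M ?F ?e"
  define U where "U = real_cond_exp M ?F Yk"
  have e2: "integrable M (\<lambda>\<omega>. (?e \<omega>)\<^sup>2)" by (rule integrable_square_diff[OF T Y T2 Y2])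
  have R_eq: "R = expectation (\<lambda>\<omega>. (?e \<omega>)\<^sup>2)"
    unfolding R_def by (simp only: square_trunc_residual[OF B] indicator_def mem_Collect_eq)
  have [measurable]: "C \<in> borel_measurable M" "U \<in> borel_measurable M" "W \<in> borel_measurable M"
    unfolding C_def U_def W_def by auto
  have C2: "integrable M (\<lambda>\<omega>. (C \<omega>)\<^sup>2)" "expectation (\<lambda>\<omega>. (C \<omega>)\<^sup>2) \<le> R"
    unfolding C_def R_eq using real_cond_exp_square_le[OF F _ e2] by auto
  have W2: "integrable M (\<lambda>\<omega>. (W \<omega>)\<^sup>2)"
    unfolding W_def by (rule real_cond_exp_square_le[OF F T T2])
  have U2: "integrable M (\<lambda>\<omega>. (U \<omega>)\<^sup>2)"
    unfolding U_def by (rule real_cond_exp_square_le[OF F Y Y2])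
  have CWU: "AE \<omega> in M. C \<omega> = W \<omega> - U \<omega>"
    unfolding C_def W_def U_def
    by (rule real_cond_exp_diff[OF square_integrable_imp_integrable[OF T T2]
          square_integrable_imp_integrable[OF Y Y2]])
  have g2: "integrable M (\<lambda>\<omega>. (g (Xk \<omega>))\<^sup>2)"
    by (rule integrable_square_bounded[where C = B]) (auto simp: gB)
  have gU: "integrable M (\<lambda>\<omega>. (g (Xk \<omega>) - U \<omega>)\<^sup>2)" and gW: "integrable M (\<lambda>\<omega>. (g (Xk \<omega>) - W \<omega>)\<^sup>2)"
    by (intro integrable_square_diff g2 U2 W2; simp)+
  have L2: "(L2_norm (distr M borel Xk) (\<lambda>x. g x - \<phi> x))\<^sup>2 = expectation (\<lambda>\<omega>. (g (Xk \<omega>) - U \<omega>)\<^sup>2)"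
  proof -
    have "(L2_norm (distr M borel Xk) (\<lambda>x. g x - \<phi> x))\<^sup>2 = (\<integral>x. (g x - \<phi> x)\<^sup>2 \<partial>distr M borel Xk)"
      unfolding L2_norm_def by simp
    also have "\<dots> = expectation (\<lambda>\<omega>. (g (Xk \<omega>) - \<phi> (Xk \<omega>))\<^sup>2)"
      by (rule integral_distr) auto
    also have "\<dots> = expectation (\<lambda>\<omega>. (g (Xk \<omega>) - U \<omega>)\<^sup>2)"
      by (rule integral_cong_AE) (use ae in \<open>auto simp: U_def\<close>)
    finally show ?thesis .
  qed
  have \<xi>: "0 \<le> \<xi> (1 / a)" using a by (simp add: \<xi>_def)
  have "expectation (\<lambda>\<omega>. (g (Xk \<omega>) - U \<omega>)\<^sup>2)
      \<le> expectation (\<lambda>\<omega>. \<xi> a * (g (Xk \<omega>) - W \<omega>)\<^sup>2 + \<xi> (1 / a) * (C \<omega>)\<^sup>2)"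
  proof (rule integral_mono_AE[OF gU])
    show "AE \<omega> in M. (g (Xk \<omega>) - U \<omega>)\<^sup>2 \<le> \<xi> a * (g (Xk \<omega>) - W \<omega>)\<^sup>2 + \<xi> (1 / a) * (C \<omega>)\<^sup>2"
      using CWU
    proof eventually_elim
      case (elim \<omega>)
      then show ?case
        using square_add_le[OF a, of "g (Xk \<omega>) - W \<omega>" "C \<omega>"] by (simp add: \<xi>_def)
    qed
  qed (use gW C2 in simp)
  also have "\<dots> = \<xi> a * expectation (\<lambda>\<omega>. (g (Xk \<omega>) - W \<omega>)\<^sup>2) + \<xi> (1 / a) * expectation (\<lambda>\<omega>. (C \<omega>)\<^sup>2)"
    using gW C2 by simp
  also have "\<dots> \<le> \<xi> a * expectation (\<lambda>\<omega>. (g (Xk \<omega>) - W \<omega>)\<^sup>2) + \<xi> (1 / a) * R"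
    by (intro add_left_mono mult_left_mono C2 \<xi>)
  finally show "(L2_norm (distr M borel Xk) (\<lambda>x. g x - \<phi> x))\<^sup>2
      \<le> \<xi> a * expectation (\<lambda>\<omega>. (g (Xk \<omega>) - W \<omega>)\<^sup>2) + \<xi> (1 / a) * R"
    unfolding L2 .
  have "expectation (\<lambda>\<omega>. (g (Xk \<omega>) - W \<omega>)\<^sup>2)
      \<le> expectation (\<lambda>\<omega>. \<xi> a * (g (Xk \<omega>) - U \<omega>)\<^sup>2 + \<xi> (1 / a) * (C \<omega>)\<^sup>2)"
  proof (rule integral_mono_AE[OF gW])
    show "AE \<omega> in M. (g (Xk \<omega>) - W \<omega>)\<^sup>2 \<le> \<xi> a * (g (Xk \<omega>) - U \<omega>)\<^sup>2 + \<xi> (1 / a) * (C \<omega>)\<^sup>2"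
      using CWU
    proof eventually_elim
      case (elim \<omega>)
      then have "g (Xk \<omega>) - W \<omega> = (g (Xk \<omega>) - U \<omega>) + - C \<omega>" by simp
      then show ?case
        using square_add_le[OF a, of "g (Xk \<omega>) - U \<omega>" "- C \<omega>"] by (simp only: \<xi>_def power2_minus)
    qed
  qed (use gU C2 in simp)
  also have "\<dots> = \<xi> a * expectation (\<lambda>\<omega>. (g (Xk \<omega>) - U \<omega>)\<^sup>2) + \<xi> (1 / a) * expectation (\<lambda>\<omega>. (C \<omega>)\<^sup>2)"
    using gU C2 by simp
  also have "\<dots> \<le> \<xi> a * expectation (\<lambda>\<omega>. (g (Xk \<omega>) - U \<omega>)\<^sup>2) + \<xi> (1 / a) * R"
    by (intro add_left_mono mult_left_mono C2 \<xi>)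
  finally show "expectation (\<lambda>\<omega>. (g (Xk \<omega>) - W \<omega>)\<^sup>2)
      \<le> \<xi> a * (L2_norm (distr M borel Xk) (\<lambda>x. g x - \<phi> x))\<^sup>2 + \<xi> (1 / a) * R"
    unfolding L2 .
qed

text \<open>The offset is paid for by the parallelogram estimate
  \<open>(v - w)\<^sup>2 \<le> 2 * (v - W)\<^sup>2 + 2 * (w - W)\<^sup>2\<close>.
  Both errors enter this estimate, which is why the error of \<open>w\<close> ends up with a larger factor than
  the error of \<open>v\<close>.\<close>
lemma (in prob_space) expectation_offset_excess_ge:
  assumes F: "subalgebra M F"
    and Z: "Z \<in> borel_measurable M" "\<And>x. \<bar>Z x\<bar> \<le> C"
    and v: "v \<in> borel_measurable F" "\<And>x. \<bar>v x\<bar> \<le> C"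
    and w: "w \<in> borel_measurable F" "\<And>x. \<bar>w x\<bar> \<le> C"
    and s: "s \<ge> 0"
  shows "(1 - 4 * s) * expectation (\<lambda>x. (v x - real_cond_exp M F Z x)\<^sup>2)
      - (1 + 4 * s) * expectation (\<lambda>x. (w x - real_cond_exp M F Z x)\<^sup>2)
    \<le> expectation (\<lambda>x. excess (Z x) (w x) (v x) - 2 * s * (v x - w x)\<^sup>2)"
proof -
  let ?W = "real_cond_exp M F Z"
  note [measurable] = Z(1) measurable_from_subalg[OF F v(1)] measurable_from_subalg[OF F w(1)]
  interpret finite_measure_subalgebra M F by unfold_locales (rule F)
  have Z2: "integrable M (\<lambda>x. (Z x)\<^sup>2)" and v2: "integrable M (\<lambda>x. (v x)\<^sup>2)"
    and w2: "integrable M (\<lambda>x. (w x)\<^sup>2)"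
    by (rule integrable_square_bounded[where C = C]; simp add: Z v w)+
  have W2: "integrable M (\<lambda>x. (?W x)\<^sup>2)" by (rule real_cond_exp_square_le[OF F Z(1) Z2])
  have vW: "integrable M (\<lambda>x. (v x - ?W x)\<^sup>2)" and wW: "integrable M (\<lambda>x. (w x - ?W x)\<^sup>2)"
    and vw: "integrable M (\<lambda>x. (v x - w x)\<^sup>2)"
    and vZ: "integrable M (\<lambda>x. (v x - Z x)\<^sup>2)" and wZ: "integrable M (\<lambda>x. (w x - Z x)\<^sup>2)"
    by (rule integrable_square_diff[OF _ _ v2 W2] integrable_square_diff[OF _ _ w2 W2]
        integrable_square_diff[OF _ _ v2 w2] integrable_square_diff[OF _ _ v2 Z2]
        integrable_square_diff[OF _ _ w2 Z2]; simp)+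
  have ex: "integrable M (\<lambda>x. excess (Z x) (w x) (v x))"
    unfolding excess_def using vZ wZ by simp
  have "expectation (\<lambda>x. (v x - w x)\<^sup>2)
      \<le> expectation (\<lambda>x. 2 * (v x - ?W x)\<^sup>2 + 2 * (w x - ?W x)\<^sup>2)"
  proof (rule integral_mono[OF vw])
    fix x
    have "(v x - w x)\<^sup>2 \<le> (1 + 1) * (v x - ?W x)\<^sup>2 + (1 + 1 / 1) * (- (w x - ?W x))\<^sup>2"
      using square_add_le[of 1 "v x - ?W x" "- (w x - ?W x)"] by simp
    then show "(v x - w x)\<^sup>2 \<le> 2 * (v x - ?W x)\<^sup>2 + 2 * (w x - ?W x)\<^sup>2"
      by (simp only: power2_minus) simp
  qed (use vW wW in simp)
  also have "\<dots> = 2 * expectation (\<lambda>x. (v x - ?W x)\<^sup>2) + 2 * expectation (\<lambda>x. (w x - ?W x)\<^sup>2)"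
    using vW wW by simp
  finally have "2 * s * expectation (\<lambda>x. (v x - w x)\<^sup>2)
      \<le> 2 * s * (2 * expectation (\<lambda>x. (v x - ?W x)\<^sup>2) + 2 * expectation (\<lambda>x. (w x - ?W x)\<^sup>2))"
    using s by (intro mult_left_mono) auto
  moreover have "expectation (\<lambda>x. excess (Z x) (w x) (v x) - 2 * s * (v x - w x)\<^sup>2)
      = (expectation (\<lambda>x. (v x - ?W x)\<^sup>2) - expectation (\<lambda>x. (w x - ?W x)\<^sup>2))
        - 2 * s * expectation (\<lambda>x. (v x - w x)\<^sup>2)"
    using ex vw by (simp add: expectation_excess[OF F Z(1) Z2 v w])
  ultimately show ?thesis by (simp add: algebra_simps)
qed

section \<open>The constants\<close>

text \<open>The covering error in the exponent; the choice of the radius makes it small compared with the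
  deviation \<open>6 * t / (1 + 3 * x)\<close>, \<open>x = lam - 1\<close>. The inequality reduces to
  \<open>0 \<le> lam * (c - 1)\<^sup>2 + 1\<close>.\<close>

lemma cover_radius_le:
  fixes c lam B \<epsilon> t :: real
  assumes "c > 1" "lam > 1" "B > 0" "0 < \<epsilon>" "\<epsilon> \<le> t"
  shows "8 * B * (1 / 2 ^ 5 * (1 / B) * (1 / (lam * (c - 1) + 1)) * (1 - 1 / c) * \<epsilon>) \<le> t / (4 * (1 + lam))"
proof -
  define d where "d = lam * (c - 1) + 1"
  have d: "d > 0" unfolding d_def using assms by (intro add_pos_pos mult_pos_pos) auto
  have "(c - 1) * (1 + lam) \<le> c * d"
  proof -
    have "0 \<le> lam * ((c - 1) * (c - 1)) + 1" using assms by (intro add_nonneg_nonneg mult_nonneg_nonneg) auto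
    also have "\<dots> = c * d - (c - 1) * (1 + lam)" unfolding d_def by (simp add: algebra_simps)
    finally show ?thesis by simp
  qed
  then have "(c - 1) / (c * d) \<le> 1 / (1 + lam)"
    using assms d by (simp add: divide_le_eq pos_le_divide_eq field_simps)
  then have "(c - 1) / (c * d) * (\<epsilon> / 4) \<le> 1 / (1 + lam) * (t / 4)"
    using assms d by (intro mult_mono) auto
  moreover have "8 * B * (1 / 2 ^ 5 * (1 / B) * (1 / d) * (1 - 1 / c) * \<epsilon>) = (c - 1) / (c * d) * (\<epsilon> / 4)"
    using assms d by (simp add: field_simps)
  ultimately show ?thesis unfolding d_def by (simp add: mult.commute)
qed

lemma b_fun_pos:
  assumes "c > 1" "lam > 1" "B > 0"
  shows "b_fun B c lam > 0"
proof -
  define D where "D = 1 / 3 * (1 - 1 / c) * (1 - 1 / lam) + (2 * lam - 1)"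
  have "D > 0"
    unfolding D_def using assms by (intro add_nonneg_pos mult_nonneg_nonneg) auto
  then show ?thesis
    unfolding b_fun_def D_def[symmetric] using assms by (intro mult_pos_pos) auto
qed

lemma b_fun_le:
  assumes "c > 1" "lam > 1" "B > 0"
  shows "b_fun B c lam \<le> (lam - 1) / (32 * B\<^sup>2 * (2 * lam - 1)\<^sup>2)"
proof -
  define D where "D = 1 / 3 * (1 - 1 / c) * (1 - 1 / lam) + (2 * lam - 1)"
  have D: "2 * lam - 1 \<le> D" unfolding D_def using assms by auto
  then have "(2 * lam - 1)\<^sup>2 \<le> D\<^sup>2" using assms by (intro power_mono) auto
  then have 1: "1 / D\<^sup>2 \<le> 1 / (2 * lam - 1)\<^sup>2" using assms D by (intro divide_left_mono mult_pos_pos) auto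
  have 2: "(1 - 1 / c) ^ 3 \<le> 1" using assms by (intro power_le_one) auto
  have 3: "1 - 1 / lam \<le> lam - 1"
  proof -
    have "0 \<le> (lam - 1)\<^sup>2 / lam" using assms by simp
    also have "\<dots> = lam - 1 - (1 - 1 / lam)" using assms by (simp add: power2_eq_square field_simps)
    finally show ?thesis by simp
  qed
  have "b_fun B c lam \<le> 1 / (2 ^ 5 * B\<^sup>2) * (1 / (2 * lam - 1)\<^sup>2) * 1 * (lam - 1)"
    unfolding b_fun_def D_def[symmetric] using assms 1 2 3
    by (intro mult_mono mult_nonneg_nonneg) auto
  also have "\<dots> = (lam - 1) / (32 * B\<^sup>2 * (2 * lam - 1)\<^sup>2)" by simp
  finally show ?thesis .
qed

text \<open>With the offset \<open>s\<close>, the factor \<open>(1 + 4 * s) / (1 - 4 * s)\<close> in front of the approximation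
  error is \<open>1 + 6 * x = 6 * lam - 5\<close>, and the deviation \<open>6 * t / (1 + 3 * x)\<close> divided by
  \<open>1 - 4 * s = 1 / (1 + 3 * x)\<close> is \<open>6 * t\<close>. These two requirements fix \<open>s\<close> and the deviation; the
  resulting exponent dominates \<open>b_fun\<close>, since the covering error takes away at most one
  eighth of the deviation.\<close>
lemma deviation_exponent_ge:
  fixes c lam B t r :: real
  defines "x \<equiv> lam - 1"
  defines "s \<equiv> 3 * x / (4 * (1 + 3 * x))"
  assumes "c > 1" "lam > 1" "B > 0" "0 < t" and r: "8 * B * r \<le> t / (4 * (1 + lam))"
  shows "b_fun B c lam * t \<le> s / (16 * B\<^sup>2) * (6 * t / (1 + 3 * x) - 8 * B * r)"
proof -
  have x: "x > 0" and lam: "lam = 1 + x" using assms by (auto simp: x_def)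
  have "t / (4 * (1 + lam)) \<le> 3 * t / (4 * (1 + 3 * x))"
    unfolding lam using x \<open>t > 0\<close> by (simp add: field_simps)
  also have "\<dots> = 6 * t / (1 + 3 * x) - 21 / 4 * t / (1 + 3 * x)"
  proof -
    define y where "y = t / (1 + 3 * x)"
    have y: "3 * t / (4 * (1 + 3 * x)) = 3 / 4 * y" "6 * t / (1 + 3 * x) = 6 * y"
      "21 / 4 * t / (1 + 3 * x) = 21 / 4 * y"
      by (simp_all add: y_def)
    show ?thesis unfolding y by simp
  qed
  finally have gap: "21 / 4 * t / (1 + 3 * x) \<le> 6 * t / (1 + 3 * x) - 8 * B * r" using r by linarith
  have "8 * (1 + 3 * x)\<^sup>2 \<le> 63 * (1 + 2 * x)\<^sup>2"
  proof -
    have "0 \<le> 55 + 204 * x + 180 * x\<^sup>2" using x by (intro add_nonneg_nonneg) auto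
    then show ?thesis by (simp add: power2_eq_square algebra_simps)
  qed
  then have "1 / (32 * (1 + 2 * x)\<^sup>2) \<le> 63 / (256 * (1 + 3 * x)\<^sup>2)"
    using x by (simp add: divide_le_eq pos_le_divide_eq field_simps)
  then have "x * t / B\<^sup>2 * (1 / (32 * (1 + 2 * x)\<^sup>2)) \<le> x * t / B\<^sup>2 * (63 / (256 * (1 + 3 * x)\<^sup>2))"
    using x \<open>t > 0\<close> by (intro mult_left_mono) auto
  moreover have "b_fun B c lam * t \<le> (lam - 1) / (32 * B\<^sup>2 * (2 * lam - 1)\<^sup>2) * t"
    using b_fun_le[of c lam B] assms by (intro mult_right_mono) auto
  moreover have "(lam - 1) / (32 * B\<^sup>2 * (2 * lam - 1)\<^sup>2) * t = x * t / B\<^sup>2 * (1 / (32 * (1 + 2 * x)\<^sup>2))"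
    unfolding lam by simp
  moreover have "x * t / B\<^sup>2 * (63 / (256 * (1 + 3 * x)\<^sup>2)) = s / (16 * B\<^sup>2) * (21 / 4 * t / (1 + 3 * x))"
  proof -
    define y where "y = 1 + 3 * x"
    show ?thesis unfolding s_def y_def[symmetric] by (simp add: power2_eq_square ac_simps)
  qed
  moreover have "\<dots> \<le> s / (16 * B\<^sup>2) * (6 * t / (1 + 3 * x) - 8 * B * r)"
    by (rule mult_left_mono[OF gap]) (use x in \<open>auto simp: s_def\<close>)
  ultimately show ?thesis by linarith
qed

lemma eps_fun_pos:
  assumes "n \<ge> 1" "c > 1" "lam > 1" "B > 0"
  shows "eps_fun n B c lam > 0"
proof -
  have "0 < c * (c + 1) * lam\<^sup>2 / real n" using assms by (intro divide_pos_pos mult_pos_pos) auto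
  then have "sqrt ((lam - 1)\<^sup>2) < sqrt ((lam - 1)\<^sup>2 + c * (c + 1) * lam\<^sup>2 / real n)"
    by (intro real_sqrt_less_mono) simp
  then have "lam - 1 < sqrt ((lam - 1)\<^sup>2 + c * (c + 1) * lam\<^sup>2 / real n)" using assms by simp
  then show ?thesis unfolding eps_fun_def using assms by (intro mult_pos_pos) auto
qed

text \<open>The factor \<open>2 * (c + 1) * (2 * c + 3)\<close> in \<^const>\<open>covA\<close> is at least \<open>1\<close>.\<close>
lemma covering_number_integral_le_cova:
  assumes "c > 1"
  shows "(\<integral>\<^sup>+\<omega>. ennreal_of_enat (covering_number n (trunc_family B G) (\<lambda>k. X k \<omega>)
       (1 / 2 ^ 5 * (1 / B) * (1 / (lam * (c - 1) + 1)) * (1 - 1 / c) * \<epsilon>)) \<partial>M)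
    \<le> cova M X n B G c lam \<epsilon>"
  unfolding cova_def covA_def
proof (rule nn_integral_mono)
  have "1 * 1 \<le> (2 * (c + 1)) * (2 * c + 3)" using assms by (intro mult_mono) auto
  then have "1 \<le> ennreal (2 * (c + 1) * (2 * c + 3))" by simp
  then show "N \<le> ennreal (2 * (c + 1) * (2 * c + 3)) * N" for N
    using mult_right_mono[of 1 "ennreal (2 * (c + 1) * (2 * c + 3))" N] by simp
qed

text \<open>For \<open>A = 0\<close> the logarithm takes the default value \<open>0\<close>, but then the left-hand side is
  \<open>0\<close>.\<close>
lemma confidence_level:
  fixes A :: ennreal and \<delta> e :: real
  assumes A: "A < \<infinity>" and \<delta>: "0 < \<delta>" and e: "ln (enn2real A) + ln (2 / \<delta>) \<le> e"
  shows "ennreal (exp (- e)) * A \<le> ennreal \<delta>"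
proof (cases "A = 0")
  case False
  define a where "a = enn2real A"
  have Aa: "A = ennreal a" unfolding a_def using A by simp
  then have a: "a > 0" using False A by (auto simp: a_def enn2real_positive_iff zero_less_iff_neq_zero)
  have "ln (2 * a / \<delta>) \<le> e" using e a \<delta> unfolding a_def[symmetric] by (simp add: ln_mult ln_div)
  then have "2 * a / \<delta> \<le> exp e" using a \<delta> by (metis exp_ln exp_le_cancel_iff divide_pos_pos mult_pos_pos zero_less_numeral)
  then have "2 * (exp (- e) * a) \<le> \<delta>" using \<delta> by (simp add: exp_minus field_simps)
  moreover have "0 \<le> exp (- e) * a" using a by simp
  ultimately have "exp (- e) * a \<le> \<delta>" by linarith
  then show ?thesis unfolding Aa using a by (simp add: ennreal_mult[symmetric] ennreal_leI)
qed simp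

section \<open>The oracle inequality for least squares with truncated responses\<close>

theorem corollary4p1:
  fixes M :: "'w measure"
    and X :: "nat \<Rightarrow> 'w \<Rightarrow> 'a::polish_space"
    and Y :: "nat \<Rightarrow> 'w \<Rightarrow> real"
    and n :: nat
    and B :: real
    and G :: "('a \<Rightarrow> real) set"
    and \<Phi> :: "nat \<Rightarrow> 'a \<Rightarrow> real"
    and ghat :: "'w \<Rightarrow> 'a \<Rightarrow> real"
    and gtilde :: "'a \<Rightarrow> real"
    and c lam \<eta> \<eta>' \<delta> :: real
  assumes "prob_space M"
    and "n \<ge> 1"
    and "B > 0"
    and "prob_space.indep_vars M (\<lambda>_. borel :: ('a \<times> real) measure)
           (\<lambda>k \<omega>. (X k \<omega>, Y k \<omega>)) {1..n}"
    and "\<And>k. k \<in> {1..n} \<Longrightarrow> integrable M (\<lambda>\<omega>. (Y k \<omega>)\<^sup>2)"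
    and "G \<noteq> {}"
    and "pointwise_measurable G"
    and "\<And>g. g \<in> G \<Longrightarrow> g \<in> borel_measurable borel"
    and "\<And>g x. g \<in> G \<Longrightarrow> \<bar>g x\<bar> \<le> B"
    and "\<And>\<omega>. \<omega> \<in> space M \<Longrightarrow>
           is_arg_min (\<lambda>g. \<Sum>k=1..n. \<bar>g (X k \<omega>) - trunc B (Y k \<omega>)\<bar>\<^sup>2) (\<lambda>g. g \<in> G) (ghat \<omega>)"
    and "is_arg_min (\<lambda>g. \<Sum>k=1..n. (\<integral>\<omega>. \<bar>g (X k \<omega>) - trunc B (Y k \<omega>)\<bar>\<^sup>2 \<partial>M))
           (\<lambda>g. g \<in> G) gtilde"
    and "\<And>k. k \<in> {1..n} \<Longrightarrow> \<Phi> k \<in> borel_measurable borel"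
    and "\<And>k. k \<in> {1..n} \<Longrightarrow>
           AE \<omega> in M. \<Phi> k (X k \<omega>) =
             real_cond_exp M (vimage_algebra (space M) (X k) borel) (Y k) \<omega>"
    and "c > 1" and "lam > 1" and "\<eta> > 0" and "\<eta>' > 0" and "0 < \<delta>" and "\<delta> < 1"
  shows "\<exists>E\<in>sets M. measure M E \<ge> 1 - \<delta> \<and>
    (\<forall>\<omega>\<in>E.
      (1 / real n) * (\<Sum>k=1..n. (L2_norm (distr M borel (X k)) (\<lambda>x. ghat \<omega> x - \<Phi> k x))\<^sup>2)
      \<le> \<xi> \<eta> *
          (\<xi> \<eta>' * (6 * lam - 5) *
             (INF g\<in>G. (1 / real n) *
                (\<Sum>k=1..n. (L2_norm (distr M borel (X k)) (\<lambda>x. g x - \<Phi> k x))\<^sup>2))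
           + 6 * max (eps_fun n B c lam)
                   (1 / (real n * b_fun B c lam) *
                     (ln (enn2real (cova M X n B G c lam (eps_fun n B c lam))) + ln (2 / \<delta>))))
        + (\<xi> (1 / \<eta>) + \<xi> \<eta> * \<xi> (1 / \<eta>') * (6 * lam - 5)) *
          ((1 / real n) *
            (\<Sum>k=1..n. (\<integral>\<omega>'. (\<bar>Y k \<omega>'\<bar> - B)\<^sup>2 * indicator {\<omega>''. \<bar>Y k \<omega>''\<bar> > B} \<omega>' \<partial>M))))"
proof -
  interpret prob_space M by fact
  note B = \<open>B > 0\<close> and n = \<open>n \<ge> 1\<close> and c = \<open>c > 1\<close> and lam = \<open>lam > 1\<close>
  note G_meas = assms(8) and G_bound = assms(9) and ghat = assms(10) and gtilde = assms(11)
  let ?J = "{1..n}"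
  let ?Z = "\<lambda>k \<omega>. trunc B (Y k \<omega>)"
  \<comment> \<open>Risks with respect to the truncated responses (\<open>V\<close>) and to the original ones (\<open>N\<close>), as sums over \<open>k\<close>: a factor \<open>n\<close> larger than the means.\<close>
  define F where "F k = vimage_algebra (space M) (X k) (borel :: 'a measure)" for k
  define W where "W k = real_cond_exp M (F k) (?Z k)" for k
  define V where "V g = (\<Sum>k=1..n. \<integral>\<omega>. (g (X k \<omega>) - W k \<omega>)\<^sup>2 \<partial>M)" for g
  define N where "N g = (\<Sum>k=1..n. (L2_norm (distr M borel (X k)) (\<lambda>x. g x - \<Phi> k x))\<^sup>2)" for g
  define R where "R = (\<Sum>k=1..n. (\<integral>\<omega>'. (\<bar>Y k \<omega>'\<bar> - B)\<^sup>2 * indicator {\<omega>''. \<bar>Y k \<omega>''\<bar> > B} \<omega>' \<partial>M))"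

  have D: "(\<lambda>\<omega>. (X k \<omega>, Y k \<omega>)) \<in> borel_measurable M" if "k \<in> ?J" for k
    using assms(4) that unfolding indep_vars_def by blast
  have X: "X k \<in> borel_measurable M" if "k \<in> ?J" for k
    using measurable_compose[OF D[OF that] borel_measurable_continuous_onI[OF continuous_on_fst[OF continuous_on_id]]]
    by simp
  have Y: "Y k \<in> borel_measurable M" if "k \<in> ?J" for k
    using measurable_compose[OF D[OF that] borel_measurable_continuous_onI[OF continuous_on_snd[OF continuous_on_id]]]
    by simp
  have Z: "?Z k \<in> borel_measurable M" if "k \<in> ?J" for k
    unfolding trunc_def using Y[OF that] by measurable
  have F: "subalgebra M (F k)" if "k \<in> ?J" for k
    unfolding F_def by (rule subalgebra_vimage_algebra) (rule X[OF that])
  have gX: "(\<lambda>\<omega>. g (X k \<omega>)) \<in> borel_measurable (F k)" if "g \<in> G" for g k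
    unfolding F_def by (rule measurable_compose[OF measurable_vimage_algebra1 G_meas[OF that]]) simp
  have Z2: "integrable M (\<lambda>\<omega>. (?Z k \<omega>)\<^sup>2)" if "k \<in> ?J" for k
    by (rule integrable_square_bounded[OF Z[OF that], of B]) (rule abs_trunc_le[OF B])
  have gt: "gtilde \<in> G" using gtilde unfolding is_arg_min_def by auto
  have gh: "ghat \<omega> \<in> G" if "\<omega> \<in> space M" for \<omega>
    using ghat that unfolding is_arg_min_def by auto

  have N_le: "N g \<le> \<xi> a * V g + \<xi> (1 / a) * R" and V_le: "V g \<le> \<xi> a * N g + \<xi> (1 / a) * R"
    if g: "g \<in> G" and a: "a > 0" for g a
    unfolding N_def V_def R_def W_def F_def sum_distrib_left sum.distrib[symmetric]
    by (intro sum_mono truncated_regression_distance B X Y assms(5) assms(12) assms(13) G_meas g G_bound a; assumption)+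

  have V_min: "V gtilde \<le> V g" if g: "g \<in> G" for g
  proof -
    have sq: "integrable M (\<lambda>\<omega>. (f (X k \<omega>) - ?Z k \<omega>)\<^sup>2)" if "f \<in> G" "k \<in> ?J" for f k
    proof -
      note m = measurable_from_subalg[OF F[OF that(2)] gX[OF that(1)]]
      show ?thesis
        by (rule integrable_square_diff[OF m Z[OF that(2)]
              integrable_square_bounded[OF m G_bound[OF that(1)]] Z2[OF that(2)]])
    qed
    have "(\<Sum>k=1..n. \<integral>\<omega>. (gtilde (X k \<omega>) - ?Z k \<omega>)\<^sup>2 \<partial>M)
        \<le> (\<Sum>k=1..n. \<integral>\<omega>. (g (X k \<omega>) - ?Z k \<omega>)\<^sup>2 \<partial>M)"
      using gtilde g unfolding is_arg_min_def power2_abs by (meson not_less)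
    moreover have "(\<integral>\<omega>. (g (X k \<omega>) - ?Z k \<omega>)\<^sup>2 \<partial>M) - (\<integral>\<omega>. (gtilde (X k \<omega>) - ?Z k \<omega>)\<^sup>2 \<partial>M)
        = (\<integral>\<omega>. (g (X k \<omega>) - W k \<omega>)\<^sup>2 \<partial>M) - (\<integral>\<omega>. (gtilde (X k \<omega>) - W k \<omega>)\<^sup>2 \<partial>M)"
      if k: "k \<in> ?J" for k
      using expectation_excess[OF F[OF k] Z[OF k] Z2[OF k] gX[OF g] G_bound[OF g] gX[OF gt] G_bound[OF gt]]
      unfolding excess_def W_def by (subst (asm) Bochner_Integration.integral_diff) (auto intro!: sq g gt k)
    then have "(\<Sum>k=1..n. (\<integral>\<omega>. (g (X k \<omega>) - ?Z k \<omega>)\<^sup>2 \<partial>M) - (\<integral>\<omega>. (gtilde (X k \<omega>) - ?Z k \<omega>)\<^sup>2 \<partial>M))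
        = V g - V gtilde"
      unfolding V_def sum_subtractf[symmetric] by (rule sum.cong[OF refl])
    ultimately show ?thesis by (simp add: sum_subtractf)
  qed

  define \<epsilon> where "\<epsilon> = eps_fun n B c lam"
  define A where "A = cova M X n B G c lam \<epsilon>"
  define b where "b = b_fun B c lam"
  \<comment> \<open>\<open>s\<close> and \<open>u\<close> are chosen such that \<open>(1 + 3 * x) * (1 - 4 * s) = 1\<close>, \<open>(1 + 3 * x) * (1 + 4 * s) = 6 * lam - 5\<close> and \<open>(1 + 3 * x) * u = 6 * t\<close>.\<close>
  define t where "t = max \<epsilon> (1 / (real n * b) * (ln (enn2real A) + ln (2 / \<delta>)))"
  \<comment> \<open>The radius belongs to \<open>\<epsilon>\<close>, the deviation to \<open>t \<ge> \<epsilon>\<close>: so the covering number is the one in \<open>A\<close>, and the covering error is still small compared with \<open>t\<close>.\<close>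
  define r where "r = 1 / 2 ^ 5 * (1 / B) * (1 / (lam * (c - 1) + 1)) * (1 - 1 / c) * \<epsilon>"
  define x where "x = lam - 1"
  define s where "s = 3 * x / (4 * (1 + 3 * x))"
  define \<theta> where "\<theta> = s / (16 * B\<^sup>2)"
  define u where "u = 6 * t / (1 + 3 * x)"
  have x: "x > 0" using lam by (simp add: x_def)
  have \<epsilon>: "\<epsilon> > 0" unfolding \<epsilon>_def by (rule eps_fun_pos[OF n c lam B])
  have t: "\<epsilon> \<le> t" "t > 0" using \<epsilon> by (auto simp: t_def)
  have b: "b > 0" unfolding b_def by (rule b_fun_pos[OF c lam B])
  have x3: "4 * (1 + 3 * x) > 0" using x by simp
  have s_eq: "s * (4 * (1 + 3 * x)) = 3 * x"
    unfolding s_def using x3 by (intro nonzero_eq_divide_eq[THEN iffD1]) auto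
  have s: "0 < s" "s \<le> 1 / 2"
    using x x3 unfolding s_def by (simp, simp add: pos_divide_le_eq)
  have \<theta>: "16 * B\<^sup>2 * \<theta> = s" using B by (simp add: \<theta>_def)
  have r: "r > 0"
    unfolding r_def using B c lam \<epsilon> by (intro mult_pos_pos divide_pos_pos add_pos_pos) auto
  have A: "A < \<infinity>"
    unfolding A_def by (rule cova_finite) (use assms(1) B n c lam \<epsilon> in auto)
  have "b * t \<le> \<theta> * (u - 8 * B * r)"
    unfolding b_def \<theta>_def s_def u_def x_def
    by (rule deviation_exponent_ge[OF c lam B t(2)])
      (unfold r_def, rule cover_radius_le[OF c lam B \<epsilon> t(1)])
  then have exponent: "real n * (b * t) \<le> \<theta> * real n * (u - 8 * B * r)"
    using mult_left_mono[of "b * t" "\<theta> * (u - 8 * B * r)" "real n"] by (simp add: mult.left_commute mult.assoc)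
  have level: "ln (enn2real A) + ln (2 / \<delta>) \<le> real n * (b * t)"
  proof -
    have "1 / (real n * b) * (ln (enn2real A) + ln (2 / \<delta>)) \<le> t" by (simp add: t_def)
    then show ?thesis using n b by (simp add: divide_le_eq mult.commute mult.left_commute)
  qed

  obtain E where E: "E \<in> sets M"
    and prob_E: "emeasure M (space M - E) \<le> ennreal (exp (- (\<theta> * real n * (u - 8 * B * r))))
        * (\<integral>\<^sup>+\<omega>. ennreal_of_enat (covering_number n (trunc_family B G) (\<lambda>k. X k \<omega>) r) \<partial>M)"
    and dev: "\<And>\<omega> g. \<omega> \<in> E \<Longrightarrow> g \<in> G \<Longrightarrow>
        (\<Sum>k=1..n. (\<integral>\<omega>'. excess (?Z k \<omega>') (gtilde (X k \<omega>')) (g (X k \<omega>'))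
              - 2 * s * (g (X k \<omega>') - gtilde (X k \<omega>'))\<^sup>2 \<partial>M)
          - excess (?Z k \<omega>) (gtilde (X k \<omega>)) (g (X k \<omega>))) \<le> real n * u"
    using uniform_excess_deviation[where X = X and Y = Y and G = G and u = u,
        OF assms(1) n B assms(4) assms(7) G_meas _ gt s \<theta> r] G_bound
    by blast
  have cova: "(\<integral>\<^sup>+\<omega>. ennreal_of_enat (covering_number n (trunc_family B G) (\<lambda>k. X k \<omega>) r) \<partial>M) \<le> A"
    unfolding A_def r_def by (rule covering_number_integral_le_cova[OF c])
  have "exp (- (\<theta> * real n * (u - 8 * B * r))) \<le> exp (- (real n * (b * t)))"
    using exponent by (subst exp_le_cancel_iff) linarith
  then have "emeasure M (space M - E) \<le> ennreal (exp (- (real n * (b * t)))) * A"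
    by (intro order_trans[OF prob_E] mult_mono cova ennreal_leI) simp_all
  also have "\<dots> \<le> ennreal \<delta>"
    by (rule confidence_level[OF A \<open>0 < \<delta>\<close> level])
  finally have "prob (space M - E) \<le> \<delta>"
    using \<open>0 < \<delta>\<close> by (simp add: emeasure_eq_measure)
  then have prob: "prob E \<ge> 1 - \<delta>"
    using prob_compl[OF E] by simp

  have main: "V (ghat \<omega>) \<le> (6 * lam - 5) * V gtilde + real n * (6 * t)" if \<omega>: "\<omega> \<in> E" for \<omega>
  proof -
    let ?g = "ghat \<omega>"
    have \<omega>M: "\<omega> \<in> space M" using sets.sets_into_space[OF E] \<omega> by auto
    note g = gh[OF \<omega>M]
    have "(\<Sum>k=1..n. (?g (X k \<omega>) - ?Z k \<omega>)\<^sup>2) \<le> (\<Sum>k=1..n. (gtilde (X k \<omega>) - ?Z k \<omega>)\<^sup>2)"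
      using ghat[OF \<omega>M] gt unfolding is_arg_min_def power2_abs by (meson not_less)
    then have erm: "(\<Sum>k=1..n. excess (?Z k \<omega>) (gtilde (X k \<omega>)) (?g (X k \<omega>))) \<le> 0"
      unfolding excess_def by (simp add: sum_subtractf)
    have "(1 - 4 * s) * V ?g - (1 + 4 * s) * V gtilde
        \<le> (\<Sum>k=1..n. \<integral>\<omega>'. excess (?Z k \<omega>') (gtilde (X k \<omega>')) (?g (X k \<omega>'))
              - 2 * s * (?g (X k \<omega>') - gtilde (X k \<omega>'))\<^sup>2 \<partial>M)"
      unfolding V_def sum_distrib_left sum_subtractf[symmetric] W_def
    proof (rule sum_mono)
      fix k assume k: "k \<in> ?J"
      show "(1 - 4 * s) * (\<integral>\<omega>. (?g (X k \<omega>) - real_cond_exp M (F k) (?Z k) \<omega>)\<^sup>2 \<partial>M)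
          - (1 + 4 * s) * (\<integral>\<omega>. (gtilde (X k \<omega>) - real_cond_exp M (F k) (?Z k) \<omega>)\<^sup>2 \<partial>M)
        \<le> (\<integral>\<omega>'. excess (?Z k \<omega>') (gtilde (X k \<omega>')) (?g (X k \<omega>'))
              - 2 * s * (?g (X k \<omega>') - gtilde (X k \<omega>'))\<^sup>2 \<partial>M)"
        using s(1) by (intro expectation_offset_excess_ge[OF F[OF k] Z[OF k] abs_trunc_le[OF B]
              gX[OF g] G_bound[OF g] gX[OF gt] G_bound[OF gt]]) simp
    qed
    also have "\<dots> \<le> real n * u"
      using dev[OF \<omega> g] erm by (simp add: sum_subtractf)
    finally have "(1 + 3 * x) * ((1 - 4 * s) * V ?g - (1 + 4 * s) * V gtilde) \<le> (1 + 3 * x) * (real n * u)"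
      using x by (intro mult_left_mono) auto
    moreover have "(1 + 3 * x) * ((1 - 4 * s) * V ?g - (1 + 4 * s) * V gtilde)
        = ((1 + 3 * x) * (1 - 4 * s)) * V ?g - ((1 + 3 * x) * (1 + 4 * s)) * V gtilde"
      by (simp only: right_diff_distrib[of "1 + 3 * x" "(1 - 4 * s) * V ?g"] mult.assoc)
    moreover have "(1 + 3 * x) * (1 - 4 * s) = 1" "(1 + 3 * x) * (1 + 4 * s) = 6 * lam - 5"
      using s_eq by (simp_all add: x_def algebra_simps)
    moreover have "(1 + 3 * x) * (real n * u) = real n * (6 * t)"
    proof -
      have "1 + 3 * x \<noteq> 0" using x by simp
      then show ?thesis by (simp add: u_def)
    qed
    ultimately show ?thesis by simp
  qed

  have V_inf: "V gtilde / real n \<le> \<xi> \<eta>' * (INF g\<in>G. (1 / real n) * N g) + \<xi> (1 / \<eta>') * (R / real n)"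
  proof -
    have \<xi>: "\<xi> \<eta>' > 0" using \<open>\<eta>' > 0\<close> by (simp add: \<xi>_def)
    have "(V gtilde / real n - \<xi> (1 / \<eta>') * (R / real n)) / \<xi> \<eta>' \<le> (INF g\<in>G. (1 / real n) * N g)"
    proof (rule cINF_greatest[OF \<open>G \<noteq> {}\<close>])
      fix g assume g: "g \<in> G"
      have "V gtilde \<le> \<xi> \<eta>' * N g + \<xi> (1 / \<eta>') * R"
        using V_min[OF g] V_le[OF g \<open>\<eta>' > 0\<close>] by linarith
      then have "V gtilde / real n \<le> (\<xi> \<eta>' * N g + \<xi> (1 / \<eta>') * R) / real n"
        by (rule divide_right_mono) simp
      also have "\<dots> = ((1 / real n) * N g) * \<xi> \<eta>' + \<xi> (1 / \<eta>') * (R / real n)"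
        by (simp add: add_divide_distrib)
      finally have "V gtilde / real n - \<xi> (1 / \<eta>') * (R / real n) \<le> ((1 / real n) * N g) * \<xi> \<eta>'"
        by linarith
      then show "(V gtilde / real n - \<xi> (1 / \<eta>') * (R / real n)) / \<xi> \<eta>' \<le> (1 / real n) * N g"
        by (subst pos_divide_le_eq[OF \<xi>])
    qed
    then have "V gtilde / real n - \<xi> (1 / \<eta>') * (R / real n) \<le> (INF g\<in>G. (1 / real n) * N g) * \<xi> \<eta>'"
      by (subst (asm) pos_divide_le_eq[OF \<xi>])
    then show ?thesis unfolding mult.commute[of "\<xi> \<eta>'"] by linarith
  qed

  have bound: "(1 / real n) * N (ghat \<omega>)
      \<le> \<xi> \<eta> * (\<xi> \<eta>' * (6 * lam - 5) * (INF g\<in>G. (1 / real n) * N g) + 6 * t)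
        + (\<xi> (1 / \<eta>) + \<xi> \<eta> * \<xi> (1 / \<eta>') * (6 * lam - 5)) * ((1 / real n) * R)"
    if \<omega>: "\<omega> \<in> E" for \<omega>
  proof -
    have g: "ghat \<omega> \<in> G" using sets.sets_into_space[OF E] \<omega> gh by auto
    have \<xi>: "\<xi> \<eta> > 0" using \<open>\<eta> > 0\<close> by (simp add: \<xi>_def)
    define I where "I = (INF g\<in>G. (1 / real n) * N g)"
    define \<rho> where "\<rho> = R / real n"
    have "V (ghat \<omega>) / real n \<le> ((6 * lam - 5) * V gtilde + real n * (6 * t)) / real n"
      by (rule divide_right_mono[OF main[OF \<omega>]]) simp
    also have "\<dots> = (6 * lam - 5) * (V gtilde / real n) + 6 * t"
      using n by (simp add: add_divide_distrib)
    also have "\<dots> \<le> (6 * lam - 5) * (\<xi> \<eta>' * I + \<xi> (1 / \<eta>') * \<rho>) + 6 * t"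
      using V_inf lam unfolding I_def \<rho>_def by (intro add_right_mono mult_left_mono) auto
    finally have V_hat: "V (ghat \<omega>) / real n \<le> (6 * lam - 5) * (\<xi> \<eta>' * I + \<xi> (1 / \<eta>') * \<rho>) + 6 * t" .
    have "(1 / real n) * N (ghat \<omega>) \<le> (1 / real n) * (\<xi> \<eta> * V (ghat \<omega>) + \<xi> (1 / \<eta>) * R)"
      by (intro mult_left_mono N_le g \<open>\<eta> > 0\<close>) simp
    also have "\<dots> = \<xi> \<eta> * (V (ghat \<omega>) / real n) + \<xi> (1 / \<eta>) * \<rho>"
      by (simp add: \<rho>_def add_divide_distrib)
    also have "\<dots> \<le> \<xi> \<eta> * ((6 * lam - 5) * (\<xi> \<eta>' * I + \<xi> (1 / \<eta>') * \<rho>) + 6 * t) + \<xi> (1 / \<eta>) * \<rho>"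
      using \<xi> by (intro add_right_mono mult_left_mono V_hat) auto
    also have "\<dots> = \<xi> \<eta> * (\<xi> \<eta>' * (6 * lam - 5) * I + 6 * t)
        + (\<xi> (1 / \<eta>) + \<xi> \<eta> * \<xi> (1 / \<eta>') * (6 * lam - 5)) * ((1 / real n) * R)"
      by (simp add: \<rho>_def algebra_simps)
    finally show ?thesis unfolding I_def .
  qed
  show ?thesis
    using E prob bound unfolding N_def R_def t_def A_def b_def \<epsilon>_def by blast
qed

end
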